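(* Let $w>0$ be real and let $\alpha,\beta>0$ with $\alpha\beta\le 1$. The optimal frame constants $A(\alpha,\beta;w)$ and $B(\alpha,\beta;w)$ of the Gabor system generated by the Cauchy kernel $g(t)=\frac1{t-iw}$ satisfy $$\frac{4\pi}{\alpha}\,\frac{\inf_\xi|\hat h(\xi)|}{(e^{\pi w/\alpha}+e^{-\pi w/\alpha})^2}\ \le\ A(\alpha,\beta;w)\ \le\ \frac{4\pi}{\alpha}\,\frac{\inf_\xi|\hat h(\xi)|}{(e^{\pi w/\alpha}-e^{-\pi w/\alpha})^2},$$ $$\frac{4\pi}{\alpha}\,\frac{\sup_\xi|\hat h(\xi)|}{(e^{\pi w/\alpha}+e^{-\pi w/\alpha})^2}\ \le\ B(\alpha,\beta;w)\ \le\ \frac{4\pi}{\alpha}\,\frac{\sup_\xi|\hat h(\xi)|}{(e^{\pi w/\alpha}-e^{-\pi w/\alpha})^2},$$ where $\hat h$ is the function defined in the context and $\inf_\xi$, $\sup_\xi$ are the essential infimum and essential supremum over $\xi\in\mathbb{R}$.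
   Context: For $m,n\in\mathbb{Z}$ put $g_{m,n}(t)=\dfrac{e^{2\pi i\beta n t}}{t-\alpha m-iw}$, $t\in\mathbb{R}$. With $\langle f,g\rangle=\int_{\mathbb{R}}f\overline g$ and the corresponding norm on $L^2(\mathbb{R})$, the optimal frame constants $A(\alpha,\beta;w)$ and $B(\alpha,\beta;w)$ are, respectively, the largest $A$ and the smallest $B$ such that $A\|f\|^2\le\sum_{m,n\in\mathbb{Z}}|\langle f,g_{m,n}\rangle|^2\le B\|f\|^2$ for all $f\in L^2(\mathbb{R})$. The function $\hat h=\hat h_{\alpha,\beta}$ is $$\hat h(\xi)=\pi\sum_{m\in\mathbb{Z}}\chi_{[-(2\alpha)^{-1},(2\alpha)^{-1}]+\beta m}(\xi)\,e^{4\pi w(\xi-\beta m)},\qquad \xi\in\mathbb{R},$$ where $\chi_E$ is the indicator function of $E$. It is the Fourier transform (with the normalization $\hat f(\xi)=\int f(t)e^{-2\pi i\xi t}dt$) of a tempered distribution $h$ and is regarded as an element of $L^\infty(\mathbb{R})$, defined almost everywhere. *)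

theory Defs
  imports "HOL-Probability.Essential_Supremum" "HOL-Library.Nat_Bijection"
begin

text \<open>
  \<open>L\<^sup>2(\<real>)\<close> is represented by its Borel representatives; all notions below depend on them only up to
  equality almost everywhere.
\<close>

definition L2 :: "(real \<Rightarrow> complex) set" where
  "L2 = {f \<in> borel_measurable lborel. integrable lborel (\<lambda>t. (norm (f t))\<^sup>2)}"

definition L2_inner :: "(real \<Rightarrow> complex) \<Rightarrow> (real \<Rightarrow> complex) \<Rightarrow> complex" where
  "L2_inner f g = (LINT t|lborel. f t * cnj (g t))"

definition L2_nrm :: "(real \<Rightarrow> complex) \<Rightarrow> real" where
  "L2_nrm f = sqrt (LINT t|lborel. (norm (f t))\<^sup>2)"

text \<open>
  The sums of squared coefficients and the frame constants are extended nonnegative reals: a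
  divergent sum has the value \<open>\<infinity>\<close>, and the upper constant is \<open>\<infinity>\<close> if there is no finite upper bound.
\<close>

definition frame_sum :: "('i \<Rightarrow> real \<Rightarrow> complex) \<Rightarrow> (real \<Rightarrow> complex) \<Rightarrow> ennreal" where
  "frame_sum G f = (\<Sum>\<^sub>\<infinity>i\<in>UNIV. ennreal ((norm (L2_inner f (G i)))\<^sup>2))"

definition lower_frame_bound :: "('i \<Rightarrow> real \<Rightarrow> complex) \<Rightarrow> ennreal \<Rightarrow> bool" where
  "lower_frame_bound G A \<longleftrightarrow> (\<forall>f\<in>L2. A * ennreal ((L2_nrm f)\<^sup>2) \<le> frame_sum G f)"

definition upper_frame_bound :: "('i \<Rightarrow> real \<Rightarrow> complex) \<Rightarrow> ennreal \<Rightarrow> bool" where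
  "upper_frame_bound G B \<longleftrightarrow> (\<forall>f\<in>L2. frame_sum G f \<le> B * ennreal ((L2_nrm f)\<^sup>2))"

text \<open>
  The supremum and the infimum are attained, see \<open>lower_frame_const_greatest\<close> and
  \<open>upper_frame_const_least\<close> below.
\<close>

definition lower_frame_const :: "('i \<Rightarrow> real \<Rightarrow> complex) \<Rightarrow> ennreal" where
  "lower_frame_const G = Sup {A. lower_frame_bound G A}"

definition upper_frame_const :: "('i \<Rightarrow> real \<Rightarrow> complex) \<Rightarrow> ennreal" where
  "upper_frame_const G = Inf {B. upper_frame_bound G B}"

lemma lower_frame_const_greatest:
  "lower_frame_bound G (lower_frame_const G)"
  "lower_frame_bound G A \<Longrightarrow> A \<le> lower_frame_const G"
proof -
  show "lower_frame_bound G (lower_frame_const G)"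
    unfolding lower_frame_bound_def
  proof
    fix f assume f: "f \<in> L2"
    let ?S = "{A. lower_frame_bound G A}"
    have "lower_frame_const G * ennreal ((L2_nrm f)\<^sup>2) = (SUP A\<in>?S. A * ennreal ((L2_nrm f)\<^sup>2))"
      unfolding lower_frame_const_def using SUP_mult_right_ennreal[where f = "\<lambda>A. A"] by simp
    also have "\<dots> \<le> frame_sum G f"
      using f by (intro SUP_least) (auto simp: lower_frame_bound_def)
    finally show "lower_frame_const G * ennreal ((L2_nrm f)\<^sup>2) \<le> frame_sum G f" .
  qed
  show "lower_frame_bound G A \<Longrightarrow> A \<le> lower_frame_const G"
    unfolding lower_frame_const_def by (intro Sup_upper) simp
qed

lemma frame_sum_eq_0:
  assumes "f \<in> L2" "L2_nrm f = 0"
  shows "frame_sum G f = 0"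
proof -
  have "(LINT t|lborel. (norm (f t))\<^sup>2) = 0"
    using assms by (simp add: L2_nrm_def)
  hence ae: "AE t in lborel. f t = 0"
    using assms integral_nonneg_eq_0_iff_AE[of lborel "\<lambda>t. (norm (f t))\<^sup>2"] by (auto simp: L2_def)
  have "L2_inner f g = 0" for g
  proof -
    have "AE t in lborel. f t * cnj (g t) = 0" using ae by eventually_elim simp
    thus ?thesis unfolding L2_inner_def by (rule integral_eq_zero_AE)
  qed
  thus ?thesis by (simp add: frame_sum_def)
qed

lemma upper_frame_const_least:
  "upper_frame_bound G (upper_frame_const G)"
  "upper_frame_bound G B \<Longrightarrow> upper_frame_const G \<le> B"
proof -
  show "upper_frame_bound G (upper_frame_const G)"
    unfolding upper_frame_bound_def
  proof
    fix f assume f: "f \<in> L2"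
    show "frame_sum G f \<le> upper_frame_const G * ennreal ((L2_nrm f)\<^sup>2)"
    proof (cases "L2_nrm f = 0")
      case True
      thus ?thesis using frame_sum_eq_0[OF f] by simp
    next
      case False
      hence c: "ennreal ((L2_nrm f)\<^sup>2) \<noteq> 0" "ennreal ((L2_nrm f)\<^sup>2) \<noteq> top" by auto
      have "frame_sum G f / ennreal ((L2_nrm f)\<^sup>2) \<le> upper_frame_const G"
        unfolding upper_frame_const_def
      proof (rule Inf_greatest)
        fix B assume "B \<in> {B. upper_frame_bound G B}"
        hence "frame_sum G f \<le> B * ennreal ((L2_nrm f)\<^sup>2)"
          using f by (simp add: upper_frame_bound_def)
        hence "frame_sum G f / ennreal ((L2_nrm f)\<^sup>2)
                 \<le> B * ennreal ((L2_nrm f)\<^sup>2) / ennreal ((L2_nrm f)\<^sup>2)"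
          by (rule divide_right_mono_ennreal)
        also have "\<dots> = B"
          using c by (simp add: ennreal_mult_divide_eq)
        finally show "frame_sum G f / ennreal ((L2_nrm f)\<^sup>2) \<le> B" .
      qed
      hence "frame_sum G f / ennreal ((L2_nrm f)\<^sup>2) * ennreal ((L2_nrm f)\<^sup>2)
               \<le> upper_frame_const G * ennreal ((L2_nrm f)\<^sup>2)"
        by (rule mult_right_mono) simp
      thus ?thesis
        using c by (simp add: ennreal_divide_times ennreal_mult_divide_eq)
    qed
  qed
  show "upper_frame_bound G B \<Longrightarrow> upper_frame_const G \<le> B"
    unfolding upper_frame_const_def by (intro Inf_lower) simp
qed

definition cauchy_gabor :: "real \<Rightarrow> real \<Rightarrow> real \<Rightarrow> int \<times> int \<Rightarrow> real \<Rightarrow> complex" where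
  "cauchy_gabor \<alpha> \<beta> w = (\<lambda>(m, n) t.
     exp (2 * of_real pi * \<i> * of_real \<beta> * of_int n * of_real t)
       / (of_real t - of_real \<alpha> * of_int m - \<i> * of_real w))"

text \<open>For \<open>\<beta> \<noteq> 0\<close> only finitely many summands are nonzero at each \<open>\<xi>\<close>.\<close>

definition hhat :: "real \<Rightarrow> real \<Rightarrow> real \<Rightarrow> real \<Rightarrow> real" where
  "hhat \<alpha> \<beta> w \<xi> = pi * (\<Sum>\<^sub>\<infinity>m\<in>(UNIV :: int set).
     indicator {- (1 / (2 * \<alpha>)) + \<beta> * of_int m .. 1 / (2 * \<alpha>) + \<beta> * of_int m} \<xi>
       * exp (4 * pi * w * (\<xi> - \<beta> * of_int m)))"

text \<open>The essential infimum, dual to \<^const>\<open>esssup\<close>.\<close>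

definition essinf :: "'a measure \<Rightarrow> ('a \<Rightarrow> 'b::{second_countable_topology, dense_linorder,
    linorder_topology, complete_linorder}) \<Rightarrow> 'b" where
  "essinf M f = (if f \<in> borel_measurable M then Liminf (ae_filter M) f else bot)"

lemma essinf_eq_AE:
  assumes f: "f \<in> borel_measurable M"
  shows "essinf M f = Sup {z. AE x in M. z \<le> f x}"
  unfolding essinf_def if_P[OF f] Liminf_def
proof (intro antisym SUP_least Sup_least; clarsimp)
  fix y assume "AE x in M. y \<le> f x"
  then have "(\<lambda>x. y \<le> f x) \<in> {P. AE x in M. P x}"
    by simp
  then show "y \<le> (SUP P\<in>{P. AE x in M. P x}. INF x\<in>Collect P. f x)"
    by (rule SUP_upper2) (auto intro: INF_greatest)
next
  fix P assume P: "AE x in M. P x"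
  show "(INF x\<in>Collect P. f x) \<le> Sup {z. AE x in M. z \<le> f x}"
  proof (rule Sup_upper; clarsimp)
    show "AE x in M. (INF x\<in>Collect P. f x) \<le> f x"
      using P by (auto elim: eventually_mono simp: INF_lower)
  qed
qed

lemma hhat_finite_support:
  fixes \<xi> \<alpha> \<beta> :: real
  assumes "\<beta> > 0"
  shows "finite {m :: int. \<xi> \<in> {- (1 / (2 * \<alpha>)) + \<beta> * of_int m .. 1 / (2 * \<alpha>) + \<beta> * of_int m}}"
proof (rule finite_subset)
  show "{m :: int. \<xi> \<in> {- (1 / (2 * \<alpha>)) + \<beta> * of_int m .. 1 / (2 * \<alpha>) + \<beta> * of_int m}}
          \<subseteq> {\<lfloor>(\<xi> - 1 / (2 * \<alpha>)) / \<beta>\<rfloor> .. \<lceil>(\<xi> + 1 / (2 * \<alpha>)) / \<beta>\<rceil>}"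
  proof
    fix m :: int
    assume "m \<in> {m. \<xi> \<in> {- (1 / (2 * \<alpha>)) + \<beta> * of_int m .. 1 / (2 * \<alpha>) + \<beta> * of_int m}}"
    hence "(\<xi> - 1 / (2 * \<alpha>)) / \<beta> \<le> of_int m" "of_int m \<le> (\<xi> + 1 / (2 * \<alpha>)) / \<beta>"
      using assms by (auto simp: pos_divide_le_eq pos_le_divide_eq mult.commute)
    thus "m \<in> {\<lfloor>(\<xi> - 1 / (2 * \<alpha>)) / \<beta>\<rfloor> .. \<lceil>(\<xi> + 1 / (2 * \<alpha>)) / \<beta>\<rceil>}"
      by (auto simp: floor_le_iff le_ceiling_iff)
  qed
qed simp

lemma hhat_measurable:
  assumes "\<beta> > 0"
  shows "hhat \<alpha> \<beta> w \<in> borel_measurable borel"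
proof -
  define F :: "int \<Rightarrow> real \<Rightarrow> real" where
    "F m \<xi> = indicator {- (1 / (2 * \<alpha>)) + \<beta> * of_int m .. 1 / (2 * \<alpha>) + \<beta> * of_int m} \<xi>
       * exp (4 * pi * w * (\<xi> - \<beta> * of_int m))" for m \<xi>
  have [measurable]: "F m \<in> borel_measurable borel" for m
    unfolding F_def by measurable
  have "(\<Sum>\<^sub>\<infinity>m\<in>UNIV. F m \<xi>) = (\<Sum>n. F (int_decode n) \<xi>)" for \<xi>
  proof -
    have fin: "finite {m. F m \<xi> \<noteq> 0}"
      by (rule finite_subset[OF _ hhat_finite_support[OF assms, of \<xi> \<alpha>]])
         (auto simp: F_def indicator_def)
    have "(\<lambda>m. F m \<xi>) summable_on {m. F m \<xi> \<noteq> 0}"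
      using fin by (rule summable_on_finite)
    hence "(\<lambda>m. F m \<xi>) summable_on UNIV"
      by (subst summable_on_cong_neutral[where T = "{m. F m \<xi> \<noteq> 0}"]) auto
    hence "(\<lambda>n. F (int_decode n) \<xi>) summable_on UNIV"
      using summable_on_reindex_bij_betw[OF bij_int_decode, of "\<lambda>m. F m \<xi>"] by simp
    hence "(\<lambda>n. F (int_decode n) \<xi>) sums (\<Sum>\<^sub>\<infinity>n. F (int_decode n) \<xi>)"
      by (intro has_sum_imp_sums has_sum_infsum)
    thus ?thesis
      using infsum_reindex_bij_betw[OF bij_int_decode, of "\<lambda>m. F m \<xi>"] by (simp add: sums_iff)
  qed
  hence "hhat \<alpha> \<beta> w = (\<lambda>\<xi>. pi * (\<Sum>n. F (int_decode n) \<xi>))"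
    by (auto simp: hhat_def F_def fun_eq_iff)
  also have "\<dots> \<in> borel_measurable borel" by measurable
  finally show ?thesis .
qed

end

theory Submission
  imports Defs "HOL-Analysis.Analysis" "HOL-Probability.Sinc_Integral"
    "HOL-Probability.Characteristic_Functions"
begin

text \<open>
  Write $f = F \sigma$ with $\sigma(t) = \sin(\pi(t+iw)/\alpha)$. On the interval
  $|\xi| \le 1/(2\alpha)$ the numbers $\pm\sigma(t)/(t-\alpha m+iw)$, $m$ an integer, are $\pi$ times the
  Fourier coefficients of $e^{2\pi i\xi(t+iw)}$, so by Parseval in $m$ and summation over $n$ the
  frame sum of $f$ is exactly $(\pi/\alpha) \int \hat h |\hat F|^2$. By Plancherel this lies
  between the essential infimum and supremum of $\hat h$ times $(\pi/\alpha) \|F\|^2$, and modulated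
  Gaussians $F$, whose transforms concentrate at an arbitrary point of continuity of $\hat h$, show
  that neither constant can be improved in terms of $F$. Passing from $F$ to $f$ only costs
  $\sinh^2(\pi w/\alpha) \le |\sigma|^2 \le \cosh^2(\pi w/\alpha)$.
\<close>

section \<open>Fourier series on an interval\<close>

text \<open>The factor \<sigma> is chosen for its zeros, the points \<alpha> k - i w with k an
  integer: for every m it cancels the pole of t -> 1/(t - \<alpha> m + i w), and all the quotients
  are band-limited to the same interval. As w > 0, no zero is real, so f can be divided by \<sigma>.
  The exponential e^(2 pi i \<xi> (t + i w)) carries the real factor e^(-2 pi w \<xi>); squared and
  rewritten with \<xi> = \<beta> n - \<eta>, this is the exponential in \<open>hhat\<close>. The
  obstacle is that exchanging the t and \<xi> integrals is justified here for integrable F, while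
  the frame constants quantify over all square integrable f. The exact formula is therefore applied
  to truncations of f and to Gaussians only. For the frame bounds, the upper one passes to the limit
  by Fatou, and the lower one then uses the upper one. For the optimality, pointwise information at
  continuity points is enough, because \<open>hhat\<close> is continuous almost everywhere.\<close>

definition fourier :: "(real \<Rightarrow> complex) \<Rightarrow> real \<Rightarrow> complex" where
  "fourier f \<xi> = (LINT t|lborel. f t * cis (- (2 * pi * \<xi> * t)))"

lemma cis_measurable [measurable]: "cis \<in> borel_measurable borel"
  by (intro borel_measurable_continuous_onI) (auto intro: continuous_intros)

lemma cnj_measurable [measurable]: "cnj \<in> borel_measurable borel"
  by (intro borel_measurable_continuous_onI) (auto intro: continuous_intros)

lemma integrable_bounded_support:
  fixes f :: "real \<Rightarrow> 'a::{banach, second_countable_topology}"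
  assumes "f \<in> borel_measurable borel" "\<And>x. norm (f x) \<le> C" "\<And>x. x \<notin> {a..b} \<Longrightarrow> f x = 0"
  shows "integrable lborel f"
proof (rule Bochner_Integration.integrable_bound)
  show "integrable lborel (\<lambda>x. C * indicator {a..b} x :: real)"
    by (intro integrable_mult_right integrable_real_indicator) (auto simp: emeasure_lborel_Icc_eq)
  show "AE x in lborel. norm (f x) \<le> norm (C * indicator {a..b} x :: real)"
  proof (rule AE_I2)
    fix x show "norm (f x) \<le> norm (C * indicator {a..b} x :: real)"
      using assms(2)[of x] assms(3)[of x] norm_ge_zero[of "f x"]
      by (auto simp: indicator_def abs_mult)
  qed
qed (use assms(1) in simp)

lemma exponential_integral:
  fixes a L :: real and k :: int
  assumes "L > 0"
  shows "(LINT x|lborel. indicator {a..a+L} x *\<^sub>R cis (2 * pi * k * x / L)) = (if k = 0 then of_real L else 0)"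
proof (cases "k = 0")
  case True
  thus ?thesis using assms by (simp add: scaleR_conv_of_real)
next
  case False
  define z where "z = 2 * pi * \<i> * k / L"
  have z: "z \<noteq> 0" using False assms by (simp add: z_def)
  have e: "cis (2 * pi * k * x / L) = exp (z * of_real x)" for x
    by (simp add: z_def cis_conv_exp field_simps)
  have "(LINT x|lborel. indicator {a..a+L} x *\<^sub>R exp (z * of_real x))
      = exp (z * of_real (a + L)) / z - exp (z * of_real a) / z"
  proof (rule integral_FTC_atLeastAtMost)
    show "a \<le> a + L" using assms by simp
    fix x :: real
    show "((\<lambda>x. exp (z * of_real x) / z) has_vector_derivative exp (z * of_real x)) (at x within {a..a+L})"
    proof (rule has_vector_derivative_real_field)
      show "((\<lambda>u. exp (z * u) / z) has_field_derivative exp (z * of_real x)) (at (of_real x))"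
        using z by (auto intro!: derivative_eq_intros)
    qed
  next
    show "continuous_on {a..a+L} (\<lambda>x. exp (z * complex_of_real x))"
      by (intro continuous_intros)
  qed
  also have "exp (z * of_real (a + L)) = exp (z * of_real a) * exp (z * L)"
    by (simp add: distrib_left exp_add)
  also have "exp (z * L) = 1"
    using assms exp_integer_2pi[of "of_int k"] by (simp add: z_def field_simps)
  finally show ?thesis using False by (simp add: e)
qed

text \<open>Expand the square, use orthogonality of the exponentials over one period, and complete
  the square in each \<open>d m\<close>. Leaving \<open>d\<close> free serves two purposes: the
  Fourier coefficients themselves remove the last term and give Bessel's inequality, while an
  arbitrary good approximant bounds the missing tail.\<close>

lemma mean_square_identity:
  fixes \<phi> :: "real \<Rightarrow> complex" and d :: "int \<Rightarrow> complex"
  assumes L: "L > 0" and [measurable]: "\<phi> \<in> borel_measurable borel"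
    and bdd: "\<And>x. norm (\<phi> x) \<le> C" and supp: "\<And>x. x \<notin> {a..a+L} \<Longrightarrow> \<phi> x = 0"
    and J: "finite J"
  shows "(LINT x|lborel. (norm (\<phi> x - indicator {a..a+L} x *\<^sub>R (\<Sum>m\<in>J. d m * cis (2 * pi * m * x / L))))\<^sup>2)
       = (LINT x|lborel. (norm (\<phi> x))\<^sup>2) - (\<Sum>m\<in>J. (norm (fourier \<phi> (m / L)))\<^sup>2) / L
         + L * (\<Sum>m\<in>J. (norm (d m - fourier \<phi> (m / L) / L))\<^sup>2)"
proof -
  define I where "I x = (indicator {a..a+L} x :: complex)" for x
  define e where "e m x = cis (2 * pi * m * x / L)" for m :: int and x
  define c where "c m = fourier \<phi> (m / L)" for m :: int
  have [measurable]: "I \<in> borel_measurable borel" unfolding I_def by measurable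
  have [measurable]: "e m \<in> borel_measurable borel" for m unfolding e_def by measurable
  have norm_I: "norm (I x) \<le> 1" for x by (simp add: I_def indicator_def)
  have norm_e: "norm (e m x) = 1" for m x by (simp add: e_def)
  have C: "C \<ge> 0" using bdd[of 0] norm_ge_zero[of "\<phi> 0"] by linarith
  have e_mult: "e m x * cnj (e n x) = e (m - n) x" for m n x
    by (simp add: e_def cis_cnj cis_mult) (simp add: diff_divide_distrib algebra_simps)
  have int_phi_e: "integrable lborel (\<lambda>x. \<phi> x * cnj (e m x))" for m
    by (rule integrable_bounded_support[where C=C and a=a and b="a+L"], measurable)
       (use bdd supp in \<open>auto simp: norm_mult norm_e\<close>)
  have int_e: "integrable lborel (\<lambda>x. I x * e m x)" for m
    by (rule integrable_bounded_support[where C=1 and a=a and b="a+L"], measurable)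
       (auto simp: norm_mult norm_e norm_I, auto simp: I_def)
  have int_e': "integrable lborel (\<lambda>x. I x * e m x * cnj (e n x))" for m n
    using int_e by (simp add: e_mult mult.assoc)
  have int_phi: "integrable lborel (\<lambda>x. \<phi> x * cnj (\<phi> x))"
    by (rule integrable_bounded_support[where C="C*C" and a=a and b="a+L"], measurable)
       (use bdd supp C in \<open>auto simp: norm_mult intro!: mult_mono\<close>)
  have ce: "(LINT x|lborel. \<phi> x * cnj (e m x)) = c m" for m
    by (simp add: c_def fourier_def e_def cis_cnj mult_ac)
  have oe: "(LINT x|lborel. I x * e m x * cnj (e n x)) = (if m = n then of_real L else 0)" for m n
  proof -
    have "I x * e m x * cnj (e n x) = indicator {a..a+L} x *\<^sub>R cis (2 * pi * real_of_int (m - n) * x / L)" for x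
      unfolding mult.assoc e_mult by (simp add: I_def e_def indicator_def mult_ac)
    thus ?thesis using exponential_integral[OF L, of a "m - n"] by simp
  qed
  define P where "P x = (\<Sum>m\<in>J. d m * e m x)" for x
  have *: "complex_of_real ((norm (\<phi> x - indicator {a..a+L} x *\<^sub>R P x))\<^sup>2)
     = \<phi> x * cnj (\<phi> x) - (\<Sum>m\<in>J. cnj (d m) * (\<phi> x * cnj (e m x)))
        - cnj (\<Sum>m\<in>J. cnj (d m) * (\<phi> x * cnj (e m x)))
        + (\<Sum>m\<in>J. \<Sum>n\<in>J. (d m * cnj (d n)) * (I x * e m x * cnj (e n x)))" for x
  proof -
    have "complex_of_real ((norm (\<phi> x - indicator {a..a+L} x *\<^sub>R P x))\<^sup>2)
       = (\<phi> x - I x * P x) * cnj (\<phi> x - I x * P x)"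
      unfolding complex_norm_square by (simp add: I_def indicator_def)
    also have "\<dots> = \<phi> x * cnj (\<phi> x) - \<phi> x * cnj (P x) - cnj (\<phi> x * cnj (P x)) + I x * P x * cnj (P x)"
    proof (cases "x \<in> {a..a+L}")
      case True
      thus ?thesis by (simp add: I_def algebra_simps)
    next
      case False
      thus ?thesis using supp[OF False] by (simp add: I_def)
    qed
    finally show ?thesis
      by (simp add: P_def sum_distrib_left sum_distrib_right mult_ac)
  qed
  have "complex_of_real (LINT x|lborel. (norm (\<phi> x - indicator {a..a+L} x *\<^sub>R P x))\<^sup>2)
     = (LINT x|lborel. \<phi> x * cnj (\<phi> x)) - (\<Sum>m\<in>J. cnj (d m) * c m) - cnj (\<Sum>m\<in>J. cnj (d m) * c m)
        + (\<Sum>m\<in>J. \<Sum>n\<in>J. (d m * cnj (d n)) * (if m = n then of_real L else 0))"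
    unfolding integral_complex_of_real[symmetric] *
    by (simp add: int_phi int_phi_e int_e' ce oe del: complex_cnj_mult cnj_sum)
  also have "(LINT x|lborel. \<phi> x * cnj (\<phi> x)) = complex_of_real (LINT x|lborel. (norm (\<phi> x))\<^sup>2)"
    by (simp only: complex_norm_square[symmetric] integral_complex_of_real)
  also have "(\<Sum>m\<in>J. \<Sum>n\<in>J. (d m * cnj (d n)) * (if m = n then of_real L else 0)) = (\<Sum>m\<in>J. L * (d m * cnj (d m)))"
    using J by (intro sum.cong) (auto simp: if_distrib mult_ac cong: if_cong)
  finally have "(LINT x|lborel. (norm (\<phi> x - indicator {a..a+L} x *\<^sub>R P x))\<^sup>2) =
     Re (complex_of_real (LINT x|lborel. (norm (\<phi> x))\<^sup>2) - (\<Sum>m\<in>J. cnj (d m) * c m) - cnj (\<Sum>m\<in>J. cnj (d m) * c m)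
       + (\<Sum>m\<in>J. L * (d m * cnj (d m))))" 
    by (metis Re_complex_of_real)
  also have "\<dots> = (LINT x|lborel. (norm (\<phi> x))\<^sup>2) + (\<Sum>m\<in>J. L * (norm (d m))\<^sup>2 - 2 * Re (cnj (d m) * c m))"
  proof -
    have "complex_of_real L * (d m * cnj (d m)) = of_real (L * (norm (d m))\<^sup>2)" for m
      by (simp only: complex_norm_square of_real_mult)
    hence "(\<Sum>m\<in>J. complex_of_real L * (d m * cnj (d m))) = of_real (\<Sum>m\<in>J. L * (norm (d m))\<^sup>2)"
      by (simp only: of_real_sum)
    thus ?thesis by (simp add: sum_subtractf sum_distrib_left algebra_simps sum.distrib)
  qed
  also have "(\<Sum>m\<in>J. L * (norm (d m))\<^sup>2 - 2 * Re (cnj (d m) * c m))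
     = (\<Sum>m\<in>J. L * (norm (d m - c m / L))\<^sup>2 - (norm (c m))\<^sup>2 / L)"
    using L by (intro sum.cong) (simp_all add: cmod_power2, simp add: power2_eq_square field_simps)
  finally show ?thesis
    by (simp add: P_def e_def c_def sum_subtractf sum_distrib_left sum_divide_distrib)
qed

section \<open>Trigonometric polynomials and their density\<close>

inductive trig_poly :: "real \<Rightarrow> (real \<Rightarrow> complex) \<Rightarrow> bool" for L where
  trig_poly_monom: "trig_poly L (\<lambda>x. c * cis (2 * pi * of_int m * x / L))"
| trig_poly_add: "trig_poly L p \<Longrightarrow> trig_poly L q \<Longrightarrow> trig_poly L (\<lambda>x. p x + q x)"

lemma trig_poly_const: "trig_poly L (\<lambda>x. c)"
  using trig_poly_monom[of L c 0] by simp

lemma trig_poly_mult_monom: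
  assumes "trig_poly L p"
  shows "trig_poly L (\<lambda>x. c * cis (2 * pi * of_int m * x / L) * p x)"
  using assms
proof induction
  case (trig_poly_monom c' m')
  have *: "trig_poly L (\<lambda>x. (c * c') * cis (2 * pi * of_int (m + m') * x / L))"
    by (rule trig_poly.trig_poly_monom)
  have eq: "(c * c') * cis (2 * pi * of_int (m + m') * x / L)
      = c * cis (2 * pi * of_int m * x / L) * (c' * cis (2 * pi * of_int m' * x / L))" for x
  proof -
    have "cis (2 * pi * of_int (m + m') * x / L) = cis (2 * pi * of_int m * x / L) * cis (2 * pi * of_int m' * x / L)"
      by (simp add: cis_mult add_divide_distrib[symmetric] algebra_simps)
    thus ?thesis by (simp add: mult_ac)
  qed
  show ?case using * by (simp only: eq)
next
  case (trig_poly_add p q)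
  thus ?case by (auto simp: distrib_left intro: trig_poly.trig_poly_add)
qed

text \<open>This closure is the reason for the inductive form of \<open>trig_poly\<close>: products
  and sums are handled by rule induction, and the coefficients are recovered afterwards in
  \<open>trig_poly_normal_form\<close>.\<close>

lemma trig_poly_mult:
  assumes "trig_poly L p" "trig_poly L q"
  shows "trig_poly L (\<lambda>x. p x * q x)"
  using assms(1)
proof induction
  case (trig_poly_monom c m)
  show ?case by (rule trig_poly_mult_monom[OF assms(2)])
next
  case (trig_poly_add p1 p2)
  thus ?case by (auto simp: distrib_right intro: trig_poly.trig_poly_add)
qed

text \<open>A real-linear functional on the complex plane has the form A z + B \<open>cnj z\<close>,
  and on the unit circle z and \<open>cnj z\<close> are the monomials of frequency 1 and -1; the
  shift by \<open>a\<close> only changes the phases of A and B. Constants, sums and products follow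
  by closure.\<close>

lemma trig_poly_real_polynomial_function:
  fixes f :: "complex \<Rightarrow> real"
  assumes "real_polynomial_function f"
  shows "trig_poly L (\<lambda>x. of_real (f (cis (2 * pi * (x - a) / L))))"
  using assms
proof induction
  case (linear f)
  interpret bounded_linear f by fact
  define A where "A = (f 1 - \<i> * f \<i>) / 2"
  define B where "B = (f 1 + \<i> * f \<i>) / 2"
  have f: "f z = Re z * f 1 + Im z * f \<i>" for z
  proof -
    have "z = Re z *\<^sub>R 1 + Im z *\<^sub>R \<i>" by (simp add: complex_eq_iff)
    hence "f z = f (Re z *\<^sub>R 1 + Im z *\<^sub>R \<i>)" by metis
    thus ?thesis by (simp add: add scaleR)
  qed
  have *: "complex_of_real (f z) = A * z + B * cnj z" for z
    unfolding f[of z] by (simp add: A_def B_def complex_eq_iff field_simps)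
  have "complex_of_real (f (cis (2 * pi * (x - a) / L)))
      = (A * cis (- (2 * pi * a / L))) * cis (2 * pi * of_int 1 * x / L)
        + (B * cis (2 * pi * a / L)) * cis (2 * pi * of_int (-1) * x / L)" for x
    unfolding * by (simp add: cis_cnj mult.assoc cis_mult) (simp add: diff_divide_distrib algebra_simps)
  thus ?case
    using trig_poly_add[OF trig_poly_monom[of L "A * cis (- (2 * pi * a / L))" 1]
        trig_poly_monom[of L "B * cis (2 * pi * a / L)" "-1"]] by presburger
next
  case (const c)
  show ?case by (rule trig_poly_const)
next
  case (add f g)
  thus ?case by (auto intro: trig_poly_add)
next
  case (mult f g)
  thus ?case by (auto intro: trig_poly_mult)
qed

lemma trig_poly_continuous: "trig_poly L p \<Longrightarrow> continuous_on UNIV p"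
  by (induction rule: trig_poly.induct) (auto intro!: continuous_intros simp: divide_inverse)

lemma trig_poly_normal_form:
  assumes "trig_poly L p"
  obtains J d where "finite J" "\<And>x. p x = (\<Sum>m\<in>J. d m * cis (2 * pi * of_int m * x / L))"
  using assms
proof (induction arbitrary: thesis)
  case (trig_poly_monom c m)
  show ?case by (rule trig_poly_monom[of "{m}" "\<lambda>_. c"]) auto
next
  case (trig_poly_add p q)
  obtain J d where 1: "finite J" "\<And>x. p x = (\<Sum>m\<in>J. d m * cis (2 * pi * of_int m * x / L))"
    using trig_poly_add.IH(1) by blast
  obtain K e where 2: "finite K" "\<And>x. q x = (\<Sum>m\<in>K. e m * cis (2 * pi * of_int m * x / L))"
    using trig_poly_add.IH(2) by blast
  show ?case
  proof (rule trig_poly_add.prems[of "J \<union> K" "\<lambda>m. (if m \<in> J then d m else 0) + (if m \<in> K then e m else 0)"])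
    fix x
    have "p x = (\<Sum>m\<in>J \<union> K. (if m \<in> J then d m else 0) * cis (2 * pi * of_int m * x / L))"
      unfolding 1 using 1(1) 2(1) by (intro sum.mono_neutral_cong_left) auto
    moreover have "q x = (\<Sum>m\<in>J \<union> K. (if m \<in> K then e m else 0) * cis (2 * pi * of_int m * x / L))"
      unfolding 2 using 1(1) 2(1) by (intro sum.mono_neutral_cong_left) auto
    ultimately show "p x + q x = (\<Sum>m\<in>J \<union> K. ((if m \<in> J then d m else 0) + (if m \<in> K then e m else 0))
        * cis (2 * pi * of_int m * x / L))"
      by (simp only: distrib_right sum.distrib)
  qed (use 1 2 in auto)
qed

text \<open>Equal end values let g descend to a continuous function on the unit circle, where
  Stone-Weierstrass provides a polynomial; pulled back to the interval, it is a trigonometric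
  polynomial.\<close>

lemma trig_poly_uniform_approx:
  fixes g :: "real \<Rightarrow> complex"
  assumes L: "L > 0" and cont: "continuous_on {a..a+L} g" and per: "g a = g (a + L)" and "e > 0"
  obtains p where "trig_poly L p" "\<And>x. x \<in> {a..a+L} \<Longrightarrow> norm (g x - p x) < e"
proof -
  define \<gamma> where "\<gamma> s = g (a + L * s)" for s
  have "path \<gamma>"
    unfolding path_def \<gamma>_def using L
    by (intro continuous_on_compose2[OF cont] continuous_intros)
       (auto intro: mult_left_le)
  moreover have "pathfinish \<gamma> = pathstart \<gamma>"
    by (simp add: \<gamma>_def pathfinish_def pathstart_def per)
  \<comment> \<open>The constant homotopy of the loop with itself yields continuity of the induced
    map on the circle, so the jump of \<open>Arg2pi\<close> at 1 need not be treated by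
    hand.\<close>
  ultimately have "homotopic_loops UNIV \<gamma> \<gamma>" by (simp add: homotopic_loops_refl)
  hence "continuous_on (sphere 0 1) (\<gamma> \<circ> (\<lambda>z. Arg2pi z / (2 * pi)))"
    using homotopic_loops_imp_homotopic_circlemaps homotopic_with_imp_continuous by blast
  from Stone_Weierstrass_polynomial_function[OF compact_sphere this \<open>e > 0\<close>]
  obtain q where q: "polynomial_function q"
      "\<And>z. z \<in> sphere 0 1 \<Longrightarrow> norm (\<gamma> (Arg2pi z / (2 * pi)) - q z) < e"
    by (auto simp: o_def)
  define p where "p x = q (cis (2 * pi * (x - a) / L))" for x
  have "real_polynomial_function (\<lambda>z. Re (q z))" "real_polynomial_function (\<lambda>z. Im (q z))"
    using q(1) bounded_linear_Re bounded_linear_Im unfolding polynomial_function_def o_def by auto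
  hence "trig_poly L (\<lambda>x. of_real (Re (p x)) + \<i> * of_real (Im (p x)))"
    unfolding p_def by (intro trig_poly_add trig_poly_mult trig_poly_const trig_poly_real_polynomial_function)
  hence "trig_poly L p" by (simp flip: complex_eq)
  moreover have "norm (g x - p x) < e" if x: "x \<in> {a..a+L}" for x
  proof -
    define z where "z = cis (2 * pi * (x - a) / L)"
    have "\<gamma> (Arg2pi z / (2 * pi)) = g x"
    \<comment> \<open>\<open>Arg2pi\<close> takes values in [0, 2 pi), so the right end point is
      sent to the parameter 0; there the equality of the end values closes the gap.\<close>
    proof (cases "x = a + L")
      case True
      hence "z = 1" using L by (simp add: z_def)
      thus ?thesis using True per by (simp add: \<gamma>_def Arg2pi_of_real[of 1, simplified])
    next
      case False
      hence "(x - a) / L < 1" using x L by auto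
      hence "2 * pi * ((x - a) / L) < 2 * pi * 1" by (intro mult_strict_left_mono) auto
      hence "Arg2pi z = 2 * pi * (x - a) / L"
        using x L by (intro Arg2pi_unique[of 1]) (auto simp: z_def cis_conv_exp)
      thus ?thesis using L by (simp add: \<gamma>_def)
    qed
    thus ?thesis using q(2)[of z] by (simp add: p_def z_def)
  qed
  ultimately show thesis using that by blast
qed

text \<open>A measurable function is an almost everywhere limit of continuous ones. Once these are
  bounded and made periodic, uniform approximation and dominated convergence on the bounded interval
  give closeness in mean square.\<close>

lemma trig_poly_mean_square_dense:
  fixes \<phi> :: "real \<Rightarrow> complex"
  assumes L: "L > 0" and [measurable]: "\<phi> \<in> borel_measurable borel"
    and bdd: "\<And>x. norm (\<phi> x) \<le> C" and supp: "\<And>x. x \<notin> {a..a+L} \<Longrightarrow> \<phi> x = 0" and "e > 0"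
  obtains p where "trig_poly L p" "(LINT x|lborel. (norm (\<phi> x - indicator {a..a+L} x *\<^sub>R p x))\<^sup>2) < e"
proof -
  have C: "C \<ge> 0" using bdd[of 0] norm_ge_zero[of "\<phi> 0"] by linarith
  have "\<phi> measurable_on UNIV"
    by (rule lebesgue_measurable_imp_measurable_on) (auto intro: measurable_completion)
  then obtain N g where N: "negligible N" and g: "\<And>n. continuous_on UNIV (g n)"
      "\<And>x. x \<notin> N \<Longrightarrow> (\<lambda>n. g n x) \<longlonglongrightarrow> \<phi> x"
    unfolding measurable_on_def by auto
  \<comment> \<open>The continuous approximants are clamped to the ball of radius \<open>C\<close> for dominated convergence, and
    cut off by \<open>\<kappa>\<close> at the end points so that they extend periodically.\<close>
  define h where "h n x = closest_point (cball 0 C) (g n x)" for n :: nat and x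
  have cont_cp: "continuous_on UNIV (closest_point (cball (0::complex) C))"
    using C by (intro continuous_on_closest_point) auto
  have h_bdd: "norm (h n x) \<le> C" for n x
    using closest_point_in_set[of "cball (0::complex) C" "g n x"] C by (simp add: h_def)
  have h_cont: "continuous_on UNIV (h n)" for n
    unfolding h_def by (rule continuous_on_compose2[OF cont_cp g(1)]) auto
  have h_lim: "(\<lambda>n. h n x) \<longlonglongrightarrow> \<phi> x" if "x \<notin> N" for x
  proof -
    have "(\<lambda>n. h n x) \<longlonglongrightarrow> closest_point (cball 0 C) (\<phi> x)"
      unfolding h_def using cont_cp g(2)[OF that]
      by (auto simp: continuous_on_def intro: tendsto_compose)
    thus ?thesis using bdd[of x] by (simp add: closest_point_self)
  qed
  define \<kappa> where "\<kappa> n x = min 1 (real n * (x - a)) * min 1 (real n * (a + L - x))" for n :: nat and x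
  have \<kappa>_bdd: "\<bar>\<kappa> n x\<bar> \<le> 1" if "x \<in> {a..a+L}" for n x
  proof -
    have "0 \<le> min 1 (real n * (x - a))" "0 \<le> min 1 (real n * (a + L - x))" using that by auto
    thus ?thesis by (simp add: \<kappa>_def abs_mult mult_le_one)
  qed
  have \<kappa>_lim: "(\<lambda>n. \<kappa> n x) \<longlonglongrightarrow> 1" if "x \<in> {a<..<a+L}" for x
  proof (rule tendsto_eventually)
    have *: "eventually (\<lambda>n. 1 \<le> real n * y) sequentially" if y: "y > 0" for y
    proof -
      obtain n0 :: nat where n0: "1 < real n0 * y" using reals_Archimedean3[OF y] by blast
      show ?thesis using eventually_ge_at_top[of n0]
      proof eventually_elim
        case (elim n)
        hence "real n0 * y \<le> real n * y" using that by (intro mult_right_mono) auto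
        thus ?case using n0 by linarith
      qed
    qed
    have "eventually (\<lambda>n. 1 \<le> real n * (x - a)) sequentially"
      "eventually (\<lambda>n. 1 \<le> real n * (a + L - x)) sequentially"
      using that by (auto intro!: *)
    thus "eventually (\<lambda>n. \<kappa> n x = 1) sequentially"
      by eventually_elim (auto simp: \<kappa>_def min_def)
  qed
  have "\<exists>p. trig_poly L p \<and> (\<forall>x\<in>{a..a+L}. norm (\<kappa> n x * h n x - p x) < 1 / Suc n)" for n
  proof -
    have "continuous_on {a..a+L} (\<lambda>x. \<kappa> n x * h n x)"
      unfolding \<kappa>_def by (intro continuous_intros continuous_on_subset[OF h_cont]) auto
    moreover have "\<kappa> n a * h n a = \<kappa> n (a + L) * h n (a + L)" by (simp add: \<kappa>_def)
    ultimately show ?thesis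
      by (rule trig_poly_uniform_approx[OF L, of a "\<lambda>x. \<kappa> n x * h n x" "1 / Suc n"]) auto
  qed
  then obtain p where p: "\<And>n. trig_poly L (p n)"
      "\<And>n x. x \<in> {a..a+L} \<Longrightarrow> norm (\<kappa> n x * h n x - p n x) < 1 / Suc n" by metis
  have [measurable]: "p n \<in> borel_measurable borel" for n
    using trig_poly_continuous[OF p(1)] by (rule borel_measurable_continuous_onI)
  have p_lim: "(\<lambda>n. p n x) \<longlonglongrightarrow> \<phi> x" if "x \<in> {a<..<a+L} - N" for x
  proof -
    have "(\<lambda>n. \<kappa> n x * h n x) \<longlonglongrightarrow> complex_of_real 1 * \<phi> x"
      using that by (intro tendsto_intros \<kappa>_lim h_lim) auto
    moreover have "(\<lambda>n. \<kappa> n x * h n x - p n x) \<longlonglongrightarrow> 0"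
    proof (rule Lim_null_comparison)
      show "eventually (\<lambda>n. norm (\<kappa> n x * h n x - p n x) \<le> 1 / Suc n) sequentially"
        using p(2)[of x] that by (auto intro!: always_eventually less_imp_le)
      show "(\<lambda>n. 1 / real (Suc n)) \<longlonglongrightarrow> 0" using LIMSEQ_Suc[OF lim_1_over_n] .
    qed
    ultimately show ?thesis using tendsto_diff by fastforce
  qed
  have p_bdd: "norm (p n x) \<le> C + 1" if "x \<in> {a..a+L}" for n x
  proof -
    have "norm (p n x) \<le> norm (\<kappa> n x * h n x) + norm (\<kappa> n x * h n x - p n x)"
      by (metis norm_minus_commute norm_triangle_sub)
    also have "norm (\<kappa> n x * h n x) \<le> 1 * C"
      using \<kappa>_bdd[OF that, of n] h_bdd[of n x] by (simp only: norm_mult norm_of_real) (intro mult_mono, auto)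
    also have "norm (\<kappa> n x * h n x - p n x) \<le> 1" 
      using p(2)[OF that, of n] by (rule order.trans[OF less_imp_le]) simp
    finally show ?thesis by simp
  qed
  have "(\<lambda>n. LINT x|lborel. (norm (\<phi> x - indicator {a..a+L} x *\<^sub>R p n x))\<^sup>2) \<longlonglongrightarrow> (LINT x::real|lborel. (0 :: real))"
  \<comment> \<open>The dominating constant is C + (C + 1): the second summand bounds
    \<open>p n\<close>, whose distance from a function bounded by C is at most 1.\<close>
  proof (rule integral_dominated_convergence[where w="\<lambda>x. (2 * C + 1)\<^sup>2 * indicator {a..a+L} x"])
    show "integrable lborel (\<lambda>x. (2 * C + 1)\<^sup>2 * indicator {a..a+L} x :: real)"
      by (intro integrable_mult_right integrable_real_indicator) (auto simp: emeasure_lborel_Icc_eq)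
    have "AE x in lborel. x \<notin> N" 
      using N AE_not_in[of N lebesgue] by (simp add: negligible_iff_null_sets AE_completion_iff)
    \<comment> \<open>At the end points \<open>\<kappa> n\<close> is 0 for every n, so convergence
      to \<phi> cannot be expected there; they are discarded as a null set.\<close>
    moreover have "AE x in lborel. x \<noteq> a" "AE x in lborel. x \<noteq> a + L" by (simp_all add: AE_lborel_singleton)
    ultimately show "AE x in lborel. (\<lambda>n. (norm (\<phi> x - indicator {a..a+L} x *\<^sub>R p n x))\<^sup>2) \<longlonglongrightarrow> 0"
    proof eventually_elim
      case (elim x)
      show ?case
      proof (cases "x \<in> {a..a+L}")
        case True
        hence "x \<in> {a<..<a+L} - N" using elim by auto
        from p_lim[OF this] have "(\<lambda>n. (norm (\<phi> x - p n x))\<^sup>2) \<longlonglongrightarrow> (norm (\<phi> x - \<phi> x))\<^sup>2"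
          by (intro tendsto_intros)
        thus ?thesis using True by simp
      qed (simp add: supp)
    qed
    fix n
    show "AE x in lborel. norm ((norm (\<phi> x - indicator {a..a+L} x *\<^sub>R p n x))\<^sup>2) \<le> (2 * C + 1)\<^sup>2 * indicator {a..a+L} x"
    proof (rule AE_I2)
      fix x
      show "norm ((norm (\<phi> x - indicator {a..a+L} x *\<^sub>R p n x))\<^sup>2) \<le> (2 * C + 1)\<^sup>2 * indicator {a..a+L} x"
      proof (cases "x \<in> {a..a+L}")
        case True
        have "norm (\<phi> x - p n x) \<le> 2 * C + 1"
          using norm_triangle_ineq4[of "\<phi> x" "p n x"] bdd[of x] p_bdd[OF True, of n] by linarith
        thus ?thesis using True by (simp add: power_mono)
      qed (simp add: supp)
    qed
  qed measurable
  hence "eventually (\<lambda>n. (LINT x|lborel. (norm (\<phi> x - indicator {a..a+L} x *\<^sub>R p n x))\<^sup>2) < e) sequentially"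
    using \<open>e > 0\<close> by (intro order_tendstoD(2)) auto
  then obtain n where "(LINT x|lborel. (norm (\<phi> x - indicator {a..a+L} x *\<^sub>R p n x))\<^sup>2) < e"
    by (meson eventually_happens trivial_limit_sequentially)
  thus thesis using that p(1) by blast
qed

text \<open>\<open>ident\<close> with the Fourier coefficients as \<open>d\<close> bounds all finite
  partial sums by the total. \<open>ident\<close> with an approximating trigonometric polynomial
  gives one finite index set whose partial sum is within e of the total, and every larger finite set
  lies in between.\<close>

theorem parseval_interval:
  fixes \<phi> :: "real \<Rightarrow> complex"
  assumes L: "L > 0" and meas: "\<phi> \<in> borel_measurable borel"
    and bdd: "\<And>x. norm (\<phi> x) \<le> C" and supp: "\<And>x. x \<notin> {a..a+L} \<Longrightarrow> \<phi> x = 0"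
  shows "((\<lambda>m::int. (norm (fourier \<phi> (m / L)))\<^sup>2) has_sum L * (LINT x|lborel. (norm (\<phi> x))\<^sup>2)) UNIV"
proof -
  let ?c = "\<lambda>m::int. (norm (fourier \<phi> (m / L)))\<^sup>2" and ?S = "L * (LINT x|lborel. (norm (\<phi> x))\<^sup>2)"
  have ident: "(LINT x|lborel. (norm (\<phi> x - indicator {a..a+L} x *\<^sub>R (\<Sum>m\<in>J. d m * cis (2 * pi * m * x / L))))\<^sup>2)
       = (LINT x|lborel. (norm (\<phi> x))\<^sup>2) - sum ?c J / L
         + L * (\<Sum>m\<in>J. (norm (d m - fourier \<phi> (m / L) / L))\<^sup>2)" if "finite J" for J :: "int set" and d :: "int \<Rightarrow> complex"
    by (rule mean_square_identity[OF L meas bdd _ that]) (rule supp)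
  have le: "sum ?c J \<le> ?S" if "finite J" for J
  proof -
    have "0 \<le> (LINT x|lborel. (norm (\<phi> x - indicator {a..a+L} x *\<^sub>R
        (\<Sum>m\<in>J. fourier \<phi> (m / L) / L * cis (2 * pi * m * x / L))))\<^sup>2)"
      by (intro Bochner_Integration.integral_nonneg) simp
    also note ident[OF that]
    finally have "0 \<le> (LINT x|lborel. (norm (\<phi> x))\<^sup>2) - sum ?c J / L" by simp
    thus ?thesis using L by (simp add: field_simps)
  qed
  show ?thesis unfolding has_sum_def
  proof (rule tendstoI)
    fix e :: real assume e: "e > 0"
    obtain p where p: "trig_poly L p"
      "(LINT x|lborel. (norm (\<phi> x - indicator {a..a+L} x *\<^sub>R p x))\<^sup>2) < e / L"
    proof (rule trig_poly_mean_square_dense[OF L meas bdd])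
      show "x \<notin> {a..a+L} \<Longrightarrow> \<phi> x = 0" for x by (rule supp)
      show "0 < e / L" using L e by simp
    qed blast
    obtain J d where J: "finite J" "\<And>x. p x = (\<Sum>m\<in>J. d m * cis (2 * pi * of_int m * x / L))"
      using trig_poly_normal_form[OF p(1)] by blast
    have "(LINT x|lborel. (norm (\<phi> x))\<^sup>2) - sum ?c J / L + L * (\<Sum>m\<in>J. (norm (d m - fourier \<phi> (m / L) / L))\<^sup>2) < e / L"
      using p(2) ident[OF J(1), where d=d] J(2) by simp
    moreover have "L * (\<Sum>m\<in>J. (norm (d m - fourier \<phi> (m / L) / L))\<^sup>2) \<ge> 0"
      using L by (intro mult_nonneg_nonneg sum_nonneg) auto
    ultimately have "(LINT x|lborel. (norm (\<phi> x))\<^sup>2) - sum ?c J / L < e / L" by linarith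
    hence "L * ((LINT x|lborel. (norm (\<phi> x))\<^sup>2) - sum ?c J / L) < L * (e / L)"
      using L by (rule mult_strict_left_mono)
    hence J': "?S - sum ?c J < e" using L by (simp add: right_diff_distrib)
    show "eventually (\<lambda>F. dist (sum ?c F) ?S < e) (finite_subsets_at_top UNIV)"
      unfolding eventually_finite_subsets_at_top
    proof (intro exI[of _ J] conjI allI impI)
      fix F :: "int set" assume F: "finite F \<and> J \<subseteq> F \<and> F \<subseteq> UNIV"
      have "sum ?c J \<le> sum ?c F" using F by (intro sum_mono2) auto
      thus "dist (sum ?c F) ?S < e" using J' le[of F] F by (simp add: dist_real_def)
    qed (use J in auto)
  qed
qed

section \<open>Plancherel theorem\<close>

text \<open>Frame sums are defined by \<open>infsum\<close>; as integrals over the counting measure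
  they become accessible to Tonelli and Fatou.\<close>

lemma infsum_eq_nn_integral_count_space:
  fixes f :: "'i::countable \<Rightarrow> ennreal"
  shows "infsum f UNIV = (\<integral>\<^sup>+i. f i \<partial>count_space UNIV)"
proof -
  have S: "infsum f UNIV = (SUP F\<in>{F. finite F \<and> F \<subseteq> UNIV}. sum f F)"
    by (rule nonneg_infsum_complete) simp
  have le: "sum f F \<le> infsum f UNIV" if "finite F" for F
    unfolding S by (rule SUP_upper) (use that in simp)
  show ?thesis
  proof (rule antisym)
    show "infsum f UNIV \<le> (\<integral>\<^sup>+i. f i \<partial>count_space UNIV)"
      unfolding S
    proof (rule SUP_least)
      fix F :: "'i set" assume "F \<in> {F. finite F \<and> F \<subseteq> UNIV}"
      hence "sum f F = (\<integral>\<^sup>+i. f i \<partial>count_space F)" by (simp add: nn_integral_count_space_finite)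
      also have "\<dots> = (\<integral>\<^sup>+i. f i * indicator F i \<partial>count_space UNIV)"
        by (rule nn_integral_count_space_indicator) simp
      also have "\<dots> \<le> (\<integral>\<^sup>+i. f i \<partial>count_space UNIV)"
        by (intro nn_integral_mono) (simp add: indicator_def)
      finally show "sum f F \<le> (\<integral>\<^sup>+i. f i \<partial>count_space UNIV)" .
    qed
  next
    show "(\<integral>\<^sup>+i. f i \<partial>count_space UNIV) \<le> infsum f UNIV"
    proof (cases "finite (UNIV :: 'i set)")
      case True
      thus ?thesis using le[OF True] by (simp add: nn_integral_count_space_finite)
    next
      case False
      define g where "g = from_nat_into (UNIV :: 'i set)"
      have g: "bij_betw g UNIV UNIV"
        unfolding g_def using False by (intro bij_betw_from_nat_into) auto
      have "(\<integral>\<^sup>+i. f i \<partial>count_space UNIV) = (\<integral>\<^sup>+n. f (g n) \<partial>count_space UNIV)"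
        by (rule nn_integral_bij_count_space[OF g, symmetric])
      also have "\<dots> = (\<Sum>n. f (g n))" by (rule nn_integral_count_space_nat)
      also have "\<dots> = (SUP n. \<Sum>k<n. f (g k))" by (rule suminf_eq_SUP)
      also have "\<dots> \<le> infsum f UNIV"
      proof (rule SUP_least)
        fix n
        have "(\<Sum>k<n. f (g k)) = sum f (g ` {..<n})"
          using g by (subst sum.reindex) (auto simp: bij_betw_def intro: inj_on_subset)
        thus "(\<Sum>k<n. f (g k)) \<le> infsum f UNIV" using le by simp
      qed
      finally show ?thesis .
    qed
  qed
qed

lemma nn_integral_count_space_has_sum:
  fixes f :: "'i::countable \<Rightarrow> real"
  assumes "(f has_sum s) UNIV" "\<And>i. f i \<ge> 0"
  shows "(\<integral>\<^sup>+i. ennreal (f i) \<partial>count_space UNIV) = ennreal s"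
proof -
  have "ennreal s = ennreal (infsum f UNIV)" using assms(1) by (simp add: infsumI)
  also have "\<dots> = (SUP F\<in>{F. finite F \<and> F \<subseteq> UNIV}. ennreal (sum f F))"
    using assms by (intro infsum_nonneg_is_SUPREMUM_ennreal) (auto simp: summable_on_def)
  also have "\<dots> = (SUP F\<in>{F. finite F \<and> F \<subseteq> UNIV}. (\<Sum>i\<in>F. ennreal (f i)))"
    using assms by (simp add: sum_ennreal)
  also have "\<dots> = (\<Sum>\<^sub>\<infinity>i. ennreal (f i))"
    by (rule nonneg_infsum_complete[symmetric]) simp
  also have "\<dots> = (\<integral>\<^sup>+i. ennreal (f i) \<partial>count_space UNIV)"
    by (rule infsum_eq_nn_integral_count_space)
  finally show ?thesis by simp
qed

section \<open>The Fourier transform, and Parseval for nonnegative integrals\<close>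

lemma fourier_measurable [measurable]:
  assumes [measurable]: "F \<in> borel_measurable borel"
  shows "fourier F \<in> borel_measurable borel"
  unfolding fourier_def by measurable

lemma norm_fourier_le: "norm (fourier F \<xi>) \<le> (LINT t|lborel. norm (F t))"
  unfolding fourier_def
  by (rule order.trans[OF integral_norm_bound]) (simp add: norm_mult)

lemma nn_integral_norm_eq_integral:
  fixes \<phi> :: "real \<Rightarrow> complex"
  assumes "\<phi> \<in> borel_measurable borel" "\<And>x. norm (\<phi> x) \<le> C" "\<And>x. x \<notin> {a..b} \<Longrightarrow> \<phi> x = 0"
  shows "(\<integral>\<^sup>+x. ennreal ((norm (\<phi> x))\<^sup>2) \<partial>lborel) = ennreal (LINT x|lborel. (norm (\<phi> x))\<^sup>2)"
proof (rule nn_integral_eq_integral)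
  note [measurable] = assms(1)
  show "integrable lborel (\<lambda>x. (norm (\<phi> x))\<^sup>2)"
    by (rule integrable_bounded_support[where C="C\<^sup>2" and a=a and b=b], measurable)
       (use assms(2,3) in \<open>auto intro: power_mono\<close>)
qed simp

lemma parseval_interval_nn:
  fixes \<phi> :: "real \<Rightarrow> complex"
  assumes L: "L > 0" and meas: "\<phi> \<in> borel_measurable borel"
    and bdd: "\<And>x. norm (\<phi> x) \<le> C" and supp: "\<And>x. x \<notin> {a..a+L} \<Longrightarrow> \<phi> x = 0"
  shows "(\<integral>\<^sup>+m. ennreal ((norm (fourier \<phi> (of_int m / L)))\<^sup>2) \<partial>count_space (UNIV :: int set))
       = ennreal L * (\<integral>\<^sup>+x. ennreal ((norm (\<phi> x))\<^sup>2) \<partial>lborel)"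
proof -
  have "((\<lambda>m::int. (norm (fourier \<phi> (m / L)))\<^sup>2) has_sum L * (LINT x|lborel. (norm (\<phi> x))\<^sup>2)) UNIV"
    by (rule parseval_interval[OF L meas bdd]) (rule supp)
  hence "(\<integral>\<^sup>+m. ennreal ((norm (fourier \<phi> (of_int m / L)))\<^sup>2) \<partial>count_space (UNIV :: int set))
     = ennreal (L * (LINT x|lborel. (norm (\<phi> x))\<^sup>2))"
    by (rule nn_integral_count_space_has_sum) simp
  also have "\<dots> = ennreal L * ennreal (LINT x|lborel. (norm (\<phi> x))\<^sup>2)"
    using L by (intro ennreal_mult) (auto intro!: Bochner_Integration.integral_nonneg)
  also have "ennreal (LINT x|lborel. (norm (\<phi> x))\<^sup>2) = (\<integral>\<^sup>+x. ennreal ((norm (\<phi> x))\<^sup>2) \<partial>lborel)"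
    by (rule nn_integral_norm_eq_integral[OF meas bdd, symmetric]) (rule supp)
  finally show ?thesis .
qed

text \<open>The translates of [0, P) by multiples of P tile the line. Exchange sum and integral,
  shift the k-th integral into its own cell, and exchange back: for each x just one index survives,
  the floor of x / P.\<close>

lemma nn_integral_periodize:
  fixes g :: "real \<Rightarrow> ennreal"
  assumes P: "P > 0" and [measurable]: "g \<in> borel_measurable borel"
  shows "(\<integral>\<^sup>+x. g x \<partial>lborel)
       = (\<integral>\<^sup>+x. (\<integral>\<^sup>+k. g (x + of_int k * P) \<partial>count_space (UNIV :: int set)) * indicator {0..<P} x \<partial>lborel)"
proof -
  have cell: "x - real_of_int k * P \<in> {0..<P} \<longleftrightarrow> k = \<lfloor>x / P\<rfloor>" for x k
  proof -
    have "x - real_of_int k * P \<in> {0..<P} \<longleftrightarrow> real_of_int k \<le> x / P \<and> x / P < real_of_int k + 1"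
      using P by (simp add: field_simps)
    thus ?thesis by (auto simp: floor_eq_iff eq_commute[of k])
  qed
  have "(\<integral>\<^sup>+x. (\<integral>\<^sup>+k. g (x + of_int k * P) \<partial>count_space (UNIV :: int set)) * indicator {0..<P} x \<partial>lborel)
     = (\<integral>\<^sup>+x. (\<integral>\<^sup>+k. g (x + of_int k * P) * indicator {0..<P} x \<partial>count_space (UNIV :: int set)) \<partial>lborel)"
    by (simp add: nn_integral_multc)
  also have "\<dots> = (\<integral>\<^sup>+k. (\<integral>\<^sup>+x. g (x + of_int k * P) * indicator {0..<P} x \<partial>lborel) \<partial>count_space (UNIV :: int set))"
    by (rule nn_integral_count_space_nn_integral) auto
  also have "\<dots> = (\<integral>\<^sup>+k. (\<integral>\<^sup>+x. g x * indicator {\<lfloor>x / P\<rfloor>} k \<partial>lborel) \<partial>count_space (UNIV :: int set))"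
  proof (rule nn_integral_cong)
    fix k :: int
    have "(\<integral>\<^sup>+x. g (x + of_int k * P) * indicator {0..<P} x \<partial>lborel)
       = (\<integral>\<^sup>+x. g (- (of_int k * P) + 1 * x + of_int k * P) * indicator {0..<P} (- (of_int k * P) + 1 * x) \<partial>lborel)"
      by (subst nn_integral_real_affine[where c=1 and t="- (of_int k * P)"]) auto
    also have "\<dots> = (\<integral>\<^sup>+x. g x * indicator {\<lfloor>x / P\<rfloor>} k \<partial>lborel)"
      using cell[of _ k] by (intro nn_integral_cong) (auto simp: indicator_def)
    finally show "(\<integral>\<^sup>+x. g (x + of_int k * P) * indicator {0..<P} x \<partial>lborel)
        = (\<integral>\<^sup>+x. g x * indicator {\<lfloor>x / P\<rfloor>} k \<partial>lborel)" .
  qed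
  also have "\<dots> = (\<integral>\<^sup>+x. (\<integral>\<^sup>+k. g x * indicator {\<lfloor>x / P\<rfloor>} k \<partial>count_space (UNIV :: int set)) \<partial>lborel)"
  proof (rule nn_integral_count_space_nn_integral[symmetric])
    fix k :: int
    have "(\<lambda>x. g x * indicator {\<lfloor>x / P\<rfloor>} k) = (\<lambda>x. g x * indicator {0..<P} (x - real_of_int k * P))"
      using cell[of _ k] by (auto simp: indicator_def fun_eq_iff)
    thus "(\<lambda>x. g x * indicator {\<lfloor>x / P\<rfloor>} k) \<in> borel_measurable lborel" by simp
  qed auto
  also have "\<dots> = (\<integral>\<^sup>+x. g x \<partial>lborel)"
    by (simp add: nn_integral_cmult)
  finally show ?thesis by simp
qed

text \<open>Parseval on the shifted lattice \<open>x + \<int>/L\<close>, integrated over \<open>x \<in> [0, 1/L)\<close>.\<close>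

theorem plancherel_bounded_support:
  fixes F :: "real \<Rightarrow> complex"
  assumes L: "L > 0" and [measurable]: "F \<in> borel_measurable borel"
    and bdd: "\<And>x. norm (F x) \<le> C" and supp: "\<And>x. x \<notin> {a..a+L} \<Longrightarrow> F x = 0"
  shows "(\<integral>\<^sup>+\<xi>. ennreal ((norm (fourier F \<xi>))\<^sup>2) \<partial>lborel) = (\<integral>\<^sup>+t. ennreal ((norm (F t))\<^sup>2) \<partial>lborel)"
proof -
  let ?I = "\<integral>\<^sup>+t. ennreal ((norm (F t))\<^sup>2) \<partial>lborel"
  have "(\<integral>\<^sup>+\<xi>. ennreal ((norm (fourier F \<xi>))\<^sup>2) \<partial>lborel)
     = (\<integral>\<^sup>+x. (\<integral>\<^sup>+k. ennreal ((norm (fourier F (x + of_int k * (1 / L))))\<^sup>2) \<partial>count_space (UNIV :: int set))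
           * indicator {0..<1/L} x \<partial>lborel)"
    using L by (intro nn_integral_periodize) auto
  also have "\<dots> = (\<integral>\<^sup>+x. ennreal L * ?I * indicator {0..<1/L} x \<partial>lborel)"
  proof (intro nn_integral_cong arg_cong2[of _ _ _ _ "(*)"] refl)
    fix x :: real
    \<comment> \<open>Modulation by x shifts the transform by x without changing the modulus of F.
      Hence the lattice sum equals L times the squared norm of F for every x, and integration over a
      cell of length 1/L removes the factor L.\<close>
    define G where "G t = F t * cis (- (2 * pi * x * t))" for t
    have "fourier F (x + of_int k * (1 / L)) = fourier G (of_int k / L)" for k
      by (simp add: fourier_def G_def mult.assoc cis_mult) (simp add: algebra_simps)
    hence "(\<integral>\<^sup>+k. ennreal ((norm (fourier F (x + of_int k * (1 / L))))\<^sup>2) \<partial>count_space (UNIV :: int set))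
       = (\<integral>\<^sup>+k. ennreal ((norm (fourier G (of_int k / L)))\<^sup>2) \<partial>count_space (UNIV :: int set))"
      by simp
    also have "\<dots> = ennreal L * (\<integral>\<^sup>+t. ennreal ((norm (G t))\<^sup>2) \<partial>lborel)"
    proof (rule parseval_interval_nn[OF L])
      show "G \<in> borel_measurable borel" unfolding G_def by measurable
    qed (use bdd supp in \<open>auto simp: G_def norm_mult\<close>)
    also have "\<dots> = ennreal L * ?I" by (simp add: G_def norm_mult)
    finally show "(\<integral>\<^sup>+k. ennreal ((norm (fourier F (x + of_int k * (1 / L))))\<^sup>2) \<partial>count_space (UNIV :: int set))
      = ennreal L * ?I" .
  qed
  also have "\<dots> = ennreal L * ?I * ennreal (1 / L)"
    using L by (simp add: nn_integral_cmult_indicator)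
  also have "\<dots> = ennreal (L * (1 / L)) * ?I"
    using L by (subst ennreal_mult) (auto simp: mult_ac)
  finally show ?thesis using L by simp
qed

section \<open>The frame sum as a weighted integral\<close>

definition sine_factor :: "real \<Rightarrow> real \<Rightarrow> real \<Rightarrow> complex" where
  "sine_factor \<alpha> w t = sin (of_real (pi / \<alpha>) * (of_real t + \<i> * of_real w))"

lemma sine_factor_measurable [measurable]: "sine_factor \<alpha> w \<in> borel_measurable borel"
  unfolding sine_factor_def
  by (intro borel_measurable_continuous_onI continuous_intros)

text \<open>The imaginary part of the argument is fixed at pi w / \<alpha>, so |sin|^2 varies with t
  only through a cosine. Its extreme values 1 and -1 complete the two squares. The denominator 4 is
  the origin of the 4 in the final constants.\<close>

lemma norm_sine_factor:
  "(norm (sine_factor \<alpha> w t))\<^sup>2 \<ge> (exp (pi * w / \<alpha>) - exp (- (pi * w / \<alpha>)))\<^sup>2 / 4"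
  "(norm (sine_factor \<alpha> w t))\<^sup>2 \<le> (exp (pi * w / \<alpha>) + exp (- (pi * w / \<alpha>)))\<^sup>2 / 4"
proof -
  define z where "z = complex_of_real (pi / \<alpha>) * (of_real t + \<i> * of_real w)"
  have Im_z: "Im z = pi * w / \<alpha>" by (simp add: z_def)
  have eq: "(norm (sine_factor \<alpha> w t))\<^sup>2
      = (exp (2 * (pi * w / \<alpha>)) + inverse (exp (2 * (pi * w / \<alpha>))) - 2 * cos (2 * Re z)) / 4"
    unfolding sine_factor_def z_def[symmetric] norm_sin_squared Im_z ..
  have "exp (2 * (pi * w / \<alpha>)) = (exp (pi * w / \<alpha>))\<^sup>2"
    by (rule exp_double)
  moreover have "inverse (exp (2 * (pi * w / \<alpha>))) = (exp (- (pi * w / \<alpha>)))\<^sup>2"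
    by (simp only: exp_double exp_minus power_inverse)
  moreover have "exp (pi * w / \<alpha>) * exp (- (pi * w / \<alpha>)) = 1"
    by (simp add: exp_minus)
  moreover define c where "c = cos (2 * Re z)"
  moreover have "- 1 \<le> c" "c \<le> 1" by (simp_all add: c_def)
  ultimately show "(norm (sine_factor \<alpha> w t))\<^sup>2 \<ge> (exp (pi * w / \<alpha>) - exp (- (pi * w / \<alpha>)))\<^sup>2 / 4"
    "(norm (sine_factor \<alpha> w t))\<^sup>2 \<le> (exp (pi * w / \<alpha>) + exp (- (pi * w / \<alpha>)))\<^sup>2 / 4"
    unfolding eq power2_diff power2_sum c_def[symmetric] by simp_all
qed

text \<open>With z the conjugated denominator, integrating e^(2 pi i z \<xi>) over |\<xi>| <= 1/(2
  \<alpha>) gives sin(pi z / \<alpha>) / (pi z). The translation by \<alpha> m moves the argument of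
  the sine by pi m, which costs only a sign.\<close>

lemma sine_factor_times_cauchy_gabor:
  assumes \<alpha>: "\<alpha> > 0" and w: "w > 0"
  shows "sine_factor \<alpha> w t * cnj (cauchy_gabor \<alpha> \<beta> w (m, n) t)
    = of_real (pi * cos (pi * of_int m)) * (LINT \<xi>|lborel. indicator {-(1/(2*\<alpha>))..1/(2*\<alpha>)} \<xi> *\<^sub>R
        (of_real (exp (- (2 * pi * w * \<xi>))) * cis (- (2 * pi * (\<alpha> * of_int m) * \<xi>))
          * cis (- (2 * pi * (\<beta> * of_int n - \<xi>) * t))))"
proof -
  define z where "z = of_real t - of_real \<alpha> * of_int m + \<i> * complex_of_real w"
  define e where "e = cis (- (2 * pi * \<beta> * of_int n * t))"
  define c where "c = 2 * pi * \<i> * z"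
  have "Im z = w" by (simp add: z_def)
  hence z: "z \<noteq> 0" using w by auto
  hence c: "c \<noteq> 0" by (simp add: c_def)
  \<comment> \<open>\<open>cos (pi * of_int m)\<close> is the sign (-1)^m. It is its own inverse,
    which is how it changes sides below.\<close>
  have sin_m: "sin (pi * of_int m) = 0" by (simp add: sin_zero_iff_int2)
  hence cos_m: "cos (pi * of_int m) * cos (pi * of_int m) = 1"
    using sin_cos_squared_add3[of "pi * of_int m"] by simp
  have "integral\<^sup>L lborel (\<lambda>\<xi>. indicator {-(1/(2*\<alpha>))..1/(2*\<alpha>)} \<xi> *\<^sub>R exp (c * of_real \<xi>))
      = exp (c * of_real (1/(2*\<alpha>))) / c - exp (c * of_real (-(1/(2*\<alpha>)))) / c"
  proof (rule integral_FTC_atLeastAtMost)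
    show "-(1/(2*\<alpha>)) \<le> 1/(2*\<alpha>)" using \<alpha> by simp
    fix x :: real
    show "((\<lambda>x. exp (c * of_real x) / c) has_vector_derivative exp (c * of_real x))
        (at x within {-(1/(2*\<alpha>))..1/(2*\<alpha>)})"
    proof (rule has_vector_derivative_real_field)
      show "((\<lambda>u. exp (c * u) / c) has_field_derivative exp (c * of_real x)) (at (of_real x))"
        using c by (auto intro!: derivative_eq_intros)
    qed
  next
    show "continuous_on {-(1/(2*\<alpha>))..1/(2*\<alpha>)} (\<lambda>x. exp (c * complex_of_real x))"
      by (intro continuous_intros)
  qed
  also have "\<dots> = sin (of_real (pi / \<alpha>) * z) / (of_real pi * z)"
    using z \<alpha> by (simp add: sin_exp_eq c_def field_simps)
  also have "of_real (pi / \<alpha>) * z = of_real (pi / \<alpha>) * (of_real t + \<i> * of_real w) - of_real (pi * of_int m)"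
    using \<alpha> by (simp add: z_def field_simps)
  also have "sin \<dots> = of_real (cos (pi * of_int m)) * sine_factor \<alpha> w t"
    unfolding sin_diff sine_factor_def cos_of_real sin_of_real sin_m by simp
  finally have int: "integral\<^sup>L lborel (\<lambda>\<xi>. indicator {-(1/(2*\<alpha>))..1/(2*\<alpha>)} \<xi> *\<^sub>R exp (c * of_real \<xi>))
     = of_real (cos (pi * of_int m)) * sine_factor \<alpha> w t / (of_real pi * z)" .
  have "cnj (cauchy_gabor \<alpha> \<beta> w (m, n) t) = e / z"
    by (simp add: cauchy_gabor_def e_def z_def cis_conv_exp exp_cnj mult_ac)
  hence "sine_factor \<alpha> w t * cnj (cauchy_gabor \<alpha> \<beta> w (m, n) t)
    = of_real (cos (pi * of_int m) * cos (pi * of_int m)) * (sine_factor \<alpha> w t * e / z)"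
    by (simp add: cos_m)
  also have "\<dots> = of_real (pi * cos (pi * of_int m)) *
      (integral\<^sup>L lborel (\<lambda>\<xi>. indicator {-(1/(2*\<alpha>))..1/(2*\<alpha>)} \<xi> *\<^sub>R exp (c * of_real \<xi>)) * e)"
    unfolding int using z by (simp add: field_simps)
  also have "integral\<^sup>L lborel (\<lambda>\<xi>. indicator {-(1/(2*\<alpha>))..1/(2*\<alpha>)} \<xi> *\<^sub>R exp (c * of_real \<xi>)) * e
      = integral\<^sup>L lborel (\<lambda>\<xi>. indicator {-(1/(2*\<alpha>))..1/(2*\<alpha>)} \<xi> *\<^sub>R (exp (c * of_real \<xi>) * e))"
    by (subst integral_mult_left_zero[symmetric]) (simp add: mult_scaleR_left)
  also have "(\<lambda>\<xi>. exp (c * of_real \<xi>) * e) = (\<lambda>\<xi>. of_real (exp (- (2 * pi * w * \<xi>)))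
      * cis (- (2 * pi * (\<alpha> * of_int m) * \<xi>)) * cis (- (2 * pi * (\<beta> * of_int n - \<xi>) * t)))"
    by (rule ext) (simp add: c_def e_def z_def cis_conv_exp exp_of_real[symmetric] exp_add[symmetric] algebra_simps)
  finally show ?thesis .
qed

text \<open>Insert the integral representation of \<sigma> times the conjugated generator and
  integrate over t first: this produces the transform of F at \<beta> n - \<xi>, and what remains is
  a Fourier coefficient in \<xi> of frequency \<alpha> m. Fubini applies because F is integrable and
  the real exponential is integrable over the compact interval; the sign disappears in the
  norm.\<close>

lemma norm_L2_inner_cauchy_gabor:
  assumes \<alpha>: "\<alpha> > 0" and w: "w > 0" and F: "integrable lborel F"
  shows "norm (L2_inner (\<lambda>t. F t * sine_factor \<alpha> w t) (cauchy_gabor \<alpha> \<beta> w (m, n)))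
    = pi * norm (fourier (\<lambda>\<xi>. indicator {-(1/(2*\<alpha>))..1/(2*\<alpha>)} \<xi> *\<^sub>R
        (of_real (exp (- (2 * pi * w * \<xi>))) * fourier F (\<beta> * of_int n - \<xi>))) (\<alpha> * of_int m))"
proof -
  have [measurable]: "F \<in> borel_measurable borel" using F by auto
  define I where "I = {-(1/(2*\<alpha>))..1/(2*\<alpha>)}"
  have [measurable]: "I \<in> sets borel" by (simp add: I_def)
  define G where "G t \<xi> = F t * (indicator I \<xi> *\<^sub>R
        (of_real (exp (- (2 * pi * w * \<xi>))) * cis (- (2 * pi * (\<alpha> * of_int m) * \<xi>))
          * cis (- (2 * pi * (\<beta> * of_int n - \<xi>) * t))))" for t \<xi>
  have [measurable]: "(\<lambda>(t, \<xi>). G t \<xi>) \<in> borel_measurable (lborel \<Otimes>\<^sub>M lborel)"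
    unfolding G_def by measurable
  have int_E: "integrable lborel (\<lambda>\<xi>. indicator I \<xi> *\<^sub>R exp (- (2 * pi * w * \<xi>)))"
    unfolding I_def by (rule borel_integrable_compact) (auto intro!: continuous_intros)
  have norm_G: "norm (G t \<xi>) = norm (F t) * (indicator I \<xi> *\<^sub>R exp (- (2 * pi * w * \<xi>)))" for t \<xi>
    by (simp add: G_def norm_mult)
  have int_G: "integrable (lborel \<Otimes>\<^sub>M lborel) (\<lambda>(t, \<xi>). G t \<xi>)"
  proof (rule lborel_pair.Fubini_integrable)
    show "integrable lborel (\<lambda>t. LINT \<xi>|lborel. norm (case (t, \<xi>) of (t, \<xi>) \<Rightarrow> G t \<xi>))"
      using F by (simp add: norm_G del: scaleR_conv_of_real)
    show "AE t in lborel. integrable lborel (\<lambda>\<xi>. case (t, \<xi>) of (t, \<xi>) \<Rightarrow> G t \<xi>)"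
    proof (rule AE_I2)
      fix t
      have "integrable lborel (\<lambda>\<xi>. norm (F t) * (indicator I \<xi> *\<^sub>R exp (- (2 * pi * w * \<xi>))))"
        by (intro integrable_mult_right int_E)
      thus "integrable lborel (\<lambda>\<xi>. case (t, \<xi>) of (t, \<xi>) \<Rightarrow> G t \<xi>)"
        by (rule Bochner_Integration.integrable_bound) (auto simp: norm_G)
    qed
  qed measurable
  have "L2_inner (\<lambda>t. F t * sine_factor \<alpha> w t) (cauchy_gabor \<alpha> \<beta> w (m, n))
     = (LINT t|lborel. of_real (pi * cos (pi * of_int m)) * (LINT \<xi>|lborel. G t \<xi>))"
    unfolding L2_inner_def
  proof (intro Bochner_Integration.integral_cong refl)
    fix t
    have G_int: "(LINT \<xi>|lborel. G t \<xi>) = F t * (LINT \<xi>|lborel. indicator I \<xi> *\<^sub>R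
        (of_real (exp (- (2 * pi * w * \<xi>))) * cis (- (2 * pi * (\<alpha> * of_int m) * \<xi>))
          * cis (- (2 * pi * (\<beta> * of_int n - \<xi>) * t))))"
      unfolding G_def by (rule integral_mult_right_zero)
    show "F t * sine_factor \<alpha> w t * cnj (cauchy_gabor \<alpha> \<beta> w (m, n) t)
        = of_real (pi * cos (pi * of_int m)) * (LINT \<xi>|lborel. G t \<xi>)"
      unfolding mult.assoc[of "F t"] sine_factor_times_cauchy_gabor[OF \<alpha> w] G_int I_def
      by (rule mult.left_commute)
  qed
  also have "\<dots> = of_real (pi * cos (pi * of_int m)) * (LINT t|lborel. LINT \<xi>|lborel. G t \<xi>)"
    by simp
  also have "(LINT t|lborel. LINT \<xi>|lborel. G t \<xi>) = (LINT \<xi>|lborel. LINT t|lborel. G t \<xi>)"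
    by (rule lborel_pair.Fubini_integral[OF int_G, symmetric])
  also have "\<dots> = (LINT \<xi>|lborel. (indicator I \<xi> *\<^sub>R
        (of_real (exp (- (2 * pi * w * \<xi>))) * fourier F (\<beta> * of_int n - \<xi>))) * cis (- (2 * pi * (\<alpha> * of_int m) * \<xi>)))"
  proof (intro Bochner_Integration.integral_cong refl)
    fix \<xi>
    have "(LINT t|lborel. G t \<xi>) = (LINT t|lborel. (F t * cis (- (2 * pi * (\<beta> * of_int n - \<xi>) * t))) *
       (indicator I \<xi> *\<^sub>R (of_real (exp (- (2 * pi * w * \<xi>))) * cis (- (2 * pi * (\<alpha> * of_int m) * \<xi>)))))"
      by (intro Bochner_Integration.integral_cong refl) (simp add: G_def mult_ac)
    also have "\<dots> = fourier F (\<beta> * of_int n - \<xi>) *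
       (indicator I \<xi> *\<^sub>R (of_real (exp (- (2 * pi * w * \<xi>))) * cis (- (2 * pi * (\<alpha> * of_int m) * \<xi>))))"
      unfolding fourier_def by (rule integral_mult_left_zero)
    finally show "(LINT t|lborel. G t \<xi>) = (indicator I \<xi> *\<^sub>R
        (of_real (exp (- (2 * pi * w * \<xi>))) * fourier F (\<beta> * of_int n - \<xi>))) * cis (- (2 * pi * (\<alpha> * of_int m) * \<xi>))"
      by (simp add: mult_ac)
  qed
  finally have "L2_inner (\<lambda>t. F t * sine_factor \<alpha> w t) (cauchy_gabor \<alpha> \<beta> w (m, n))
    = of_real (pi * cos (pi * of_int m)) * fourier (\<lambda>\<xi>. indicator I \<xi> *\<^sub>R
        (of_real (exp (- (2 * pi * w * \<xi>))) * fourier F (\<beta> * of_int n - \<xi>))) (\<alpha> * of_int m)"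
    unfolding fourier_def[of "\<lambda>\<xi>. indicator I \<xi> *\<^sub>R _ \<xi>"] .
  moreover have "\<bar>cos (pi * of_int m)\<bar> = 1"
    using sin_cos_squared_add3[of "pi * of_int m"] by (simp add: sin_zero_iff_int2 abs_square_eq_1 power2_eq_square[symmetric])
  ultimately show ?thesis by (simp add: norm_mult abs_mult I_def del: of_real_mult)
qed

text \<open>The interval is symmetric, so it contains \<beta> n - \<eta> exactly when it contains
  \<eta> - \<beta> n. The first form is the one that the substitution \<xi> = \<beta> n - \<eta>
  produces in the frame sum.\<close>

lemma hhat_nn:
  assumes "\<beta> > 0"
  shows "ennreal (hhat \<alpha> \<beta> w \<eta>) = ennreal pi * (\<integral>\<^sup>+n. ennreal (indicator {-(1/(2*\<alpha>))..1/(2*\<alpha>)} (\<beta> * of_int n - \<eta>)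
     * exp (4 * pi * w * (\<eta> - \<beta> * of_int n))) \<partial>count_space (UNIV :: int set))" (is "_ = _ * ?N")
    and "hhat \<alpha> \<beta> w \<eta> \<ge> 0"
proof -
  define f where "f m = indicator {- (1 / (2 * \<alpha>)) + \<beta> * of_int m .. 1 / (2 * \<alpha>) + \<beta> * of_int m} \<eta>
       * exp (4 * pi * w * (\<eta> - \<beta> * of_int m))" for m :: int
  define M where "M = {m :: int. \<eta> \<in> {- (1 / (2 * \<alpha>)) + \<beta> * of_int m .. 1 / (2 * \<alpha>) + \<beta> * of_int m}}"
  have "finite M" unfolding M_def by (rule hhat_finite_support[OF assms])
  hence "(f has_sum sum f M) M" by (rule has_sum_finite)
  hence *: "(f has_sum sum f M) UNIV"
    by (subst has_sum_cong_neutral[where T = M and g = f]) (auto simp: f_def M_def)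
  hence h: "hhat \<alpha> \<beta> w \<eta> = pi * sum f M"
    unfolding hhat_def f_def[symmetric] by (simp add: infsumI)
  have "sum f M \<ge> 0" by (intro sum_nonneg) (simp add: f_def)
  thus "hhat \<alpha> \<beta> w \<eta> \<ge> 0" unfolding h by simp
  have "?N = (\<integral>\<^sup>+n. ennreal (f n) \<partial>count_space UNIV)"
    by (intro nn_integral_cong arg_cong[of _ _ ennreal]) (auto simp: f_def indicator_def)
  also have "\<dots> = ennreal (sum f M)"
    by (rule nn_integral_count_space_has_sum[OF *]) (simp add: f_def)
  finally show "ennreal (hhat \<alpha> \<beta> w \<eta>) = ennreal pi * ?N"
    unfolding h using \<open>sum f M \<ge> 0\<close> by (simp add: ennreal_mult)
qed

text \<open>The sum over m is Parseval on an interval of length 1/\<alpha>; after the reflection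
  \<xi> = \<beta> n - \<eta> the transform of F no longer depends on n, so Tonelli lets the weights
  add up to \<open>hhat\<close>. The constant collects pi^2 from the squared coefficients,
  1/\<alpha> from Parseval, and 1/pi because \<open>hhat\<close> contains a factor pi.\<close>

theorem frame_sum_cauchy_gabor:
  assumes \<alpha>: "\<alpha> > 0" and \<beta>: "\<beta> > 0" and w: "w > 0" and F: "integrable lborel F"
  shows "frame_sum (cauchy_gabor \<alpha> \<beta> w) (\<lambda>t. F t * sine_factor \<alpha> w t)
    = ennreal (pi / \<alpha>) * (\<integral>\<^sup>+\<eta>. ennreal (hhat \<alpha> \<beta> w \<eta>) * ennreal ((norm (fourier F \<eta>))\<^sup>2) \<partial>lborel)"
proof -
  have [measurable]: "F \<in> borel_measurable borel" using F by auto
  define I where "I = {-(1/(2*\<alpha>))..1/(2*\<alpha>)}"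
  have [measurable]: "I \<in> sets borel" by (simp add: I_def)
  define \<phi> where "\<phi> n \<xi> = indicator I \<xi> *\<^sub>R
        (of_real (exp (- (2 * pi * w * \<xi>))) * fourier F (\<beta> * of_int n - \<xi>))" for n :: int and \<xi>
  have [measurable]: "\<phi> n \<in> borel_measurable borel" for n unfolding \<phi>_def by measurable
  define K where "K = (LINT t|lborel. norm (F t))"
  have K: "K \<ge> 0" unfolding K_def by (intro Bochner_Integration.integral_nonneg) simp
  \<comment> \<open>Parseval was proved for bounded functions. The transform is bounded by the
    integral of the norm of F, and the exponential is largest at the left end point -1/(2
    \<alpha>).\<close>
  have bdd: "norm (\<phi> n \<xi>) \<le> exp (pi * w / \<alpha>) * K" for n \<xi>
  proof (cases "\<xi> \<in> I")
    case True
    hence "- (2 * pi * w) * \<xi> \<le> 2 * pi * w * (1 / (2 * \<alpha>))"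
      using w mult_left_mono[of "- \<xi>" "1 / (2 * \<alpha>)" "2 * pi * w"] by (auto simp: I_def)
    hence "exp (- (2 * pi * w * \<xi>)) \<le> exp (pi * w / \<alpha>)" using \<alpha> by (simp add: field_simps)
    thus ?thesis using norm_fourier_le[of F] True by (auto simp: \<phi>_def norm_mult K_def intro!: mult_mono)
  qed (use K in \<open>simp add: \<phi>_def\<close>)
  have "frame_sum (cauchy_gabor \<alpha> \<beta> w) (\<lambda>t. F t * sine_factor \<alpha> w t)
    = (\<integral>\<^sup>+mn. ennreal ((norm (L2_inner (\<lambda>t. F t * sine_factor \<alpha> w t) (cauchy_gabor \<alpha> \<beta> w mn)))\<^sup>2) \<partial>count_space UNIV)"
    unfolding frame_sum_def by (rule infsum_eq_nn_integral_count_space)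
  also have "\<dots> = (\<integral>\<^sup>+n. (\<integral>\<^sup>+m. ennreal ((norm (L2_inner (\<lambda>t. F t * sine_factor \<alpha> w t) (cauchy_gabor \<alpha> \<beta> w (m, n))))\<^sup>2)
      \<partial>count_space (UNIV :: int set)) \<partial>count_space (UNIV :: int set))"
    by (rule nn_integral_snd_count_space[symmetric])
  also have "\<dots> = (\<integral>\<^sup>+n. ennreal (pi\<^sup>2 / \<alpha>) * (\<integral>\<^sup>+\<eta>. ennreal (indicator I (\<beta> * of_int n - \<eta>)
     * exp (4 * pi * w * (\<eta> - \<beta> * of_int n))) * ennreal ((norm (fourier F \<eta>))\<^sup>2) \<partial>lborel) \<partial>count_space (UNIV :: int set))"
  proof (intro nn_integral_cong)
    fix n :: int
    have "(\<integral>\<^sup>+m. ennreal ((norm (L2_inner (\<lambda>t. F t * sine_factor \<alpha> w t) (cauchy_gabor \<alpha> \<beta> w (m, n))))\<^sup>2) \<partial>count_space (UNIV :: int set))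
      = (\<integral>\<^sup>+m. ennreal (pi\<^sup>2) * ennreal ((norm (fourier (\<phi> n) (of_int m / (1 / \<alpha>))))\<^sup>2) \<partial>count_space (UNIV :: int set))"
      unfolding norm_L2_inner_cauchy_gabor[OF \<alpha> w F] I_def[symmetric] \<phi>_def[symmetric]
      by (simp add: power_mult_distrib ennreal_mult mult.commute[of \<alpha>])
    also have "\<dots> = ennreal (pi\<^sup>2) * (\<integral>\<^sup>+m. ennreal ((norm (fourier (\<phi> n) (of_int m / (1 / \<alpha>))))\<^sup>2) \<partial>count_space (UNIV :: int set))"
      by (rule nn_integral_cmult) simp
    also have "(\<integral>\<^sup>+m. ennreal ((norm (fourier (\<phi> n) (of_int m / (1 / \<alpha>))))\<^sup>2) \<partial>count_space (UNIV :: int set))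
      = ennreal (1 / \<alpha>) * (\<integral>\<^sup>+\<xi>. ennreal ((norm (\<phi> n \<xi>))\<^sup>2) \<partial>lborel)"
    proof (rule parseval_interval_nn[where a = "-(1/(2*\<alpha>))"])
      show "\<xi> \<notin> {-(1/(2*\<alpha>))..-(1/(2*\<alpha>)) + 1/\<alpha>} \<Longrightarrow> \<phi> n \<xi> = 0" for \<xi>
        using \<alpha> by (simp add: \<phi>_def I_def)
      show "norm (\<phi> n \<xi>) \<le> exp (pi * w / \<alpha>) * K" for \<xi> by (rule bdd)
    qed (use \<alpha> in auto)
    also have "(\<integral>\<^sup>+\<xi>. ennreal ((norm (\<phi> n \<xi>))\<^sup>2) \<partial>lborel)
       = (\<integral>\<^sup>+\<eta>. ennreal ((norm (\<phi> n (\<beta> * of_int n + (-1) * \<eta>)))\<^sup>2) \<partial>lborel)"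
      by (subst nn_integral_real_affine[where c = "-1" and t = "\<beta> * of_int n"]) auto
    also have "\<dots> = (\<integral>\<^sup>+\<eta>. ennreal (indicator I (\<beta> * of_int n - \<eta>)
     * exp (4 * pi * w * (\<eta> - \<beta> * of_int n))) * ennreal ((norm (fourier F \<eta>))\<^sup>2) \<partial>lborel)"
    proof (intro nn_integral_cong)
      fix \<eta> :: real
      have "(exp (- (2 * pi * w * (\<beta> * of_int n - \<eta>))))\<^sup>2 = exp (4 * pi * w * (\<eta> - \<beta> * of_int n))"
        by (simp add: algebra_simps flip: exp_double)
      hence "(norm (\<phi> n (\<beta> * of_int n + (-1) * \<eta>)))\<^sup>2
        = (indicator I (\<beta> * of_int n - \<eta>) * exp (4 * pi * w * (\<eta> - \<beta> * of_int n))) * (norm (fourier F \<eta>))\<^sup>2"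
        by (simp add: \<phi>_def norm_mult power_mult_distrib indicator_def)
      thus "ennreal ((norm (\<phi> n (\<beta> * of_int n + (-1) * \<eta>)))\<^sup>2) = ennreal (indicator I (\<beta> * of_int n - \<eta>)
         * exp (4 * pi * w * (\<eta> - \<beta> * of_int n))) * ennreal ((norm (fourier F \<eta>))\<^sup>2)"
        by (simp add: ennreal_mult)
    qed
    finally show "(\<integral>\<^sup>+m. ennreal ((norm (L2_inner (\<lambda>t. F t * sine_factor \<alpha> w t) (cauchy_gabor \<alpha> \<beta> w (m, n))))\<^sup>2) \<partial>count_space (UNIV :: int set))
      = ennreal (pi\<^sup>2 / \<alpha>) * (\<integral>\<^sup>+\<eta>. ennreal (indicator I (\<beta> * of_int n - \<eta>)
     * exp (4 * pi * w * (\<eta> - \<beta> * of_int n))) * ennreal ((norm (fourier F \<eta>))\<^sup>2) \<partial>lborel)"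
      using \<alpha> ennreal_mult[of "pi\<^sup>2" "1 / \<alpha>"] by (simp add: mult.assoc[symmetric])
  qed
  also have "\<dots> = ennreal (pi\<^sup>2 / \<alpha>) * (\<integral>\<^sup>+n. (\<integral>\<^sup>+\<eta>. ennreal (indicator I (\<beta> * of_int n - \<eta>)
     * exp (4 * pi * w * (\<eta> - \<beta> * of_int n))) * ennreal ((norm (fourier F \<eta>))\<^sup>2) \<partial>lborel) \<partial>count_space (UNIV :: int set))"
    by (rule nn_integral_cmult) simp
  also have "(\<integral>\<^sup>+n. (\<integral>\<^sup>+\<eta>. ennreal (indicator I (\<beta> * of_int n - \<eta>)
     * exp (4 * pi * w * (\<eta> - \<beta> * of_int n))) * ennreal ((norm (fourier F \<eta>))\<^sup>2) \<partial>lborel) \<partial>count_space (UNIV :: int set))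
    = (\<integral>\<^sup>+\<eta>. (\<integral>\<^sup>+n. ennreal (indicator I (\<beta> * of_int n - \<eta>)
     * exp (4 * pi * w * (\<eta> - \<beta> * of_int n))) * ennreal ((norm (fourier F \<eta>))\<^sup>2) \<partial>count_space (UNIV :: int set)) \<partial>lborel)"
    by (rule nn_integral_count_space_nn_integral[symmetric]) auto
  also have "\<dots> = (\<integral>\<^sup>+\<eta>. ennreal (1 / pi) * (ennreal (hhat \<alpha> \<beta> w \<eta>) * ennreal ((norm (fourier F \<eta>))\<^sup>2)) \<partial>lborel)"
  proof (intro nn_integral_cong)
    fix \<eta> :: real
    have "ennreal (1 / pi) * ennreal (hhat \<alpha> \<beta> w \<eta>) = ennreal (1 / pi * pi) * (\<integral>\<^sup>+n. ennreal (indicator I (\<beta> * of_int n - \<eta>)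
     * exp (4 * pi * w * (\<eta> - \<beta> * of_int n))) \<partial>count_space (UNIV :: int set))"
      unfolding hhat_nn(1)[OF \<beta>] I_def[symmetric] by (subst ennreal_mult) (auto simp: mult.assoc)
    thus "(\<integral>\<^sup>+n. ennreal (indicator I (\<beta> * of_int n - \<eta>)
     * exp (4 * pi * w * (\<eta> - \<beta> * of_int n))) * ennreal ((norm (fourier F \<eta>))\<^sup>2) \<partial>count_space (UNIV :: int set))
     = ennreal (1 / pi) * (ennreal (hhat \<alpha> \<beta> w \<eta>) * ennreal ((norm (fourier F \<eta>))\<^sup>2))"
      by (simp add: nn_integral_multc mult.assoc[symmetric])
  qed
  also have "\<dots> = ennreal (1 / pi) * (\<integral>\<^sup>+\<eta>. ennreal (hhat \<alpha> \<beta> w \<eta>) * ennreal ((norm (fourier F \<eta>))\<^sup>2) \<partial>lborel)"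
    using hhat_measurable[OF \<beta>, of \<alpha> w, measurable] by (intro nn_integral_cmult) measurable
  also have "ennreal (pi\<^sup>2 / \<alpha>) * \<dots> = ennreal (pi\<^sup>2 / \<alpha> * (1 / pi)) * (\<integral>\<^sup>+\<eta>. ennreal (hhat \<alpha> \<beta> w \<eta>) * ennreal ((norm (fourier F \<eta>))\<^sup>2) \<partial>lborel)"
    using \<alpha> by (subst ennreal_mult) (auto simp: mult.assoc)
  finally show ?thesis by (simp add: power2_eq_square)
qed

section \<open>Regularity of the weight and square integrable functions\<close>

text \<open>A bounded window meets only finitely many of the shifted intervals, so one index set
  serves all its points. Boundedness and continuity of \<open>hhat\<close> are then questions about
  a finite sum.\<close>

lemma hhat_eq_finite_sum:
  assumes \<beta>: "\<beta> > 0"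
  obtains M :: "int set" where "finite M"
    "\<And>\<xi>. \<bar>\<xi>\<bar> \<le> R \<Longrightarrow> hhat \<alpha> \<beta> w \<xi> = pi * (\<Sum>m\<in>M.
       indicator {- (1 / (2 * \<alpha>)) + \<beta> * of_int m .. 1 / (2 * \<alpha>) + \<beta> * of_int m} \<xi>
         * exp (4 * pi * w * (\<xi> - \<beta> * of_int m)))"
proof -
  \<comment> \<open>If the interval with index m meets [-R, R], then \<beta> |m| is at most R plus
    the half-length; the absolute value covers either sign of \<alpha>.\<close>
  define r where "r = (R + \<bar>1 / (2 * \<alpha>)\<bar>) / \<beta>"
  define M where "M = {- \<lceil>r\<rceil>..\<lceil>r\<rceil>}"
  show thesis
  proof (rule that[of M])
    show "finite M" by (simp add: M_def)
    fix \<xi> :: real assume \<xi>: "\<bar>\<xi>\<bar> \<le> R"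
    let ?f = "\<lambda>m::int. indicator {- (1 / (2 * \<alpha>)) + \<beta> * of_int m .. 1 / (2 * \<alpha>) + \<beta> * of_int m} \<xi>
         * exp (4 * pi * w * (\<xi> - \<beta> * of_int m))"
    have "?f m = 0" if "m \<notin> M" for m
    proof -
      have "\<xi> \<notin> {- (1 / (2 * \<alpha>)) + \<beta> * of_int m .. 1 / (2 * \<alpha>) + \<beta> * of_int m}"
      proof
        assume "\<xi> \<in> {- (1 / (2 * \<alpha>)) + \<beta> * of_int m .. 1 / (2 * \<alpha>) + \<beta> * of_int m}"
        moreover have "1 / (2 * \<alpha>) \<le> \<bar>1 / (2 * \<alpha>)\<bar>" by (rule abs_ge_self)
        ultimately have "\<beta> * of_int m \<le> R + \<bar>1 / (2 * \<alpha>)\<bar>" "\<beta> * (- of_int m) \<le> R + \<bar>1 / (2 * \<alpha>)\<bar>"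
          using \<xi> unfolding atLeastAtMost_iff mult_minus_right by linarith+
        hence "of_int m \<le> r" "- of_int m \<le> r"
          using \<beta> by (auto simp: r_def pos_le_divide_eq mult.commute)
        hence "m \<in> M" unfolding M_def by (simp, linarith)
        thus False using that by simp
      qed
      thus ?thesis by simp
    qed
    hence "infsum ?f UNIV = infsum ?f M" by (intro infsum_cong_neutral) auto
    thus "hhat \<alpha> \<beta> w \<xi> = pi * sum ?f M"
      by (simp add: hhat_def M_def)
  qed
qed

lemma hhat_shift: "hhat \<alpha> \<beta> w (\<xi> + \<beta> * of_int k) = hhat \<alpha> \<beta> w \<xi>"
proof -
  have "bij (\<lambda>m::int. m + k)" by (rule bij_betw_byWitness[where f' = "\<lambda>m. m - k"]) auto
  from infsum_reindex_bij_betw[OF this, of "\<lambda>m. indicator {- (1 / (2 * \<alpha>)) + \<beta> * of_int m .. 1 / (2 * \<alpha>) + \<beta> * of_int m}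
     (\<xi> + \<beta> * of_int k) * exp (4 * pi * w * (\<xi> + \<beta> * of_int k - \<beta> * of_int m))"]
  have "hhat \<alpha> \<beta> w (\<xi> + \<beta> * of_int k) = pi * (\<Sum>\<^sub>\<infinity>m\<in>(UNIV :: int set).
     indicator {- (1 / (2 * \<alpha>)) + \<beta> * of_int (m + k) .. 1 / (2 * \<alpha>) + \<beta> * of_int (m + k)} (\<xi> + \<beta> * of_int k)
       * exp (4 * pi * w * (\<xi> + \<beta> * of_int k - \<beta> * of_int (m + k))))"
    by (simp add: hhat_def)
  also have "\<dots> = hhat \<alpha> \<beta> w \<xi>"
    unfolding hhat_def by (intro arg_cong2[of _ _ _ _ "(*)"] refl infsum_cong) (auto simp: indicator_def algebra_simps)
  finally show ?thesis .
qed

text \<open>Periodicity moves \<xi> into [0, \<beta>], where a single finite sum represents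
  \<open>hhat\<close>; each summand is at most the value of its exponential at the right end of its
  interval. The bound makes the candidate constants finite and supplies a dominating function in the
  Gaussian limit.\<close>

lemma hhat_bounded:
  assumes \<beta>: "\<beta> > 0" and w: "w > 0"
  obtains K where "\<And>\<xi>. hhat \<alpha> \<beta> w \<xi> \<le> K"
proof -
  obtain M :: "int set" where M: "finite M"
    "\<And>\<xi>. \<bar>\<xi>\<bar> \<le> \<beta> \<Longrightarrow> hhat \<alpha> \<beta> w \<xi> = pi * (\<Sum>m\<in>M.
       indicator {- (1 / (2 * \<alpha>)) + \<beta> * of_int m .. 1 / (2 * \<alpha>) + \<beta> * of_int m} \<xi>
         * exp (4 * pi * w * (\<xi> - \<beta> * of_int m)))"
    using hhat_eq_finite_sum[OF \<beta>] by blast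
  define E where "E = exp (4 * pi * w * (1 / (2 * \<alpha>)))"
  show thesis
  proof (rule that)
    fix \<xi> :: real
    define \<eta> where "\<eta> = \<xi> + \<beta> * of_int (- \<lfloor>\<xi> / \<beta>\<rfloor>)"
    have "0 \<le> \<eta>" "\<eta> \<le> \<beta>"
      using \<beta> floor_divide_lower[OF \<beta>, of \<xi>] floor_divide_upper[OF \<beta>, of \<xi>]
      by (auto simp: \<eta>_def algebra_simps)
    hence "hhat \<alpha> \<beta> w \<eta> = pi * (\<Sum>m\<in>M.
       indicator {- (1 / (2 * \<alpha>)) + \<beta> * of_int m .. 1 / (2 * \<alpha>) + \<beta> * of_int m} \<eta>
         * exp (4 * pi * w * (\<eta> - \<beta> * of_int m)))" by (intro M) simp
    also have "\<dots> \<le> pi * (\<Sum>m\<in>M. E)"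
    proof (intro mult_left_mono sum_mono)
      fix m :: int
      show "indicator {- (1 / (2 * \<alpha>)) + \<beta> * of_int m .. 1 / (2 * \<alpha>) + \<beta> * of_int m} \<eta>
         * exp (4 * pi * w * (\<eta> - \<beta> * of_int m)) \<le> E"
      proof (cases "\<eta> \<in> {- (1 / (2 * \<alpha>)) + \<beta> * of_int m .. 1 / (2 * \<alpha>) + \<beta> * of_int m}")
        case True
        hence "4 * pi * w * (\<eta> - \<beta> * of_int m) \<le> 4 * pi * w * (1 / (2 * \<alpha>))"
          using w by (intro mult_left_mono) auto
        thus ?thesis using True unfolding E_def by simp
      qed (simp add: E_def)
    qed simp
    finally show "hhat \<alpha> \<beta> w \<xi> \<le> pi * (\<Sum>m\<in>M. E)"
      unfolding \<eta>_def hhat_shift .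
  qed
qed

text \<open>Jumps can occur only at end points of the shifted intervals, which form a countable set.
  An estimate at all continuity points is therefore an estimate almost everywhere.\<close>

lemma AE_isCont_hhat:
  assumes \<alpha>: "\<alpha> > 0" and \<beta>: "\<beta> > 0"
  shows "AE \<xi> in lborel. isCont (hhat \<alpha> \<beta> w) \<xi>"
proof -
  define D where "D = (\<Union>m::int. {- (1 / (2 * \<alpha>)) + \<beta> * of_int m, 1 / (2 * \<alpha>) + \<beta> * of_int m})"
  have "countable D" unfolding D_def by (intro countable_UN) auto
  hence "AE \<xi> in lborel. \<xi> \<notin> D" by (intro AE_not_in countable_imp_null_set_lborel)
  thus ?thesis
  proof eventually_elim
    case (elim \<xi>)
    obtain M :: "int set" where M: "finite M"
      "\<And>x. \<bar>x\<bar> \<le> \<bar>\<xi>\<bar> + 1 \<Longrightarrow> hhat \<alpha> \<beta> w x = pi * (\<Sum>m\<in>M.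
         indicator {- (1 / (2 * \<alpha>)) + \<beta> * of_int m .. 1 / (2 * \<alpha>) + \<beta> * of_int m} x
           * exp (4 * pi * w * (x - \<beta> * of_int m)))"
      using hhat_eq_finite_sum[OF \<beta>] by blast
    have "eventually (\<lambda>x. x \<in> {- (\<bar>\<xi>\<bar> + 1)<..<\<bar>\<xi>\<bar> + 1}) (nhds \<xi>)"
      by (intro eventually_nhds_in_open) auto
    hence ev: "eventually (\<lambda>x. hhat \<alpha> \<beta> w x = pi * (\<Sum>m\<in>M.
         indicator {- (1 / (2 * \<alpha>)) + \<beta> * of_int m .. 1 / (2 * \<alpha>) + \<beta> * of_int m} x
           * exp (4 * pi * w * (x - \<beta> * of_int m)))) (nhds \<xi>)"
      by eventually_elim (rule M, auto)
    have "isCont (\<lambda>x. pi * (\<Sum>m\<in>M.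
         indicator {- (1 / (2 * \<alpha>)) + \<beta> * of_int m .. 1 / (2 * \<alpha>) + \<beta> * of_int m} x
           * exp (4 * pi * w * (x - \<beta> * of_int m)))) \<xi>"
    proof (intro continuous_intros)
      fix m :: int
      have "frontier {- (1 / (2 * \<alpha>)) + \<beta> * of_int m .. 1 / (2 * \<alpha>) + \<beta> * of_int m}
         = {- (1 / (2 * \<alpha>)) + \<beta> * of_int m, 1 / (2 * \<alpha>) + \<beta> * of_int m}"
        using \<alpha> by (auto simp: frontier_def interior_atLeastAtMost_real)
      thus "isCont (indicator {- (1 / (2 * \<alpha>)) + \<beta> * of_int m .. 1 / (2 * \<alpha>) + \<beta> * of_int m} :: real \<Rightarrow> real) \<xi>"
        using elim unfolding isCont_indicator D_def by auto
    qed
    thus ?case unfolding isCont_cong[OF ev] .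
  qed
qed

text \<open>The supremum that defines \<open>essinf\<close> is already the supremum of a sequence of
  almost everywhere lower bounds, and countably many exceptional null sets form a null set.\<close>

lemma essinf_AE:
  fixes f :: "'a \<Rightarrow> ennreal"
  assumes f: "f \<in> borel_measurable M"
  shows "AE x in M. essinf M f \<le> f x"
proof -
  let ?S = "{z. AE x in M. z \<le> f x}"
  have "0 \<in> ?S" by simp
  hence "?S \<noteq> {}" by blast
  from ennreal_Sup_countable_SUP[OF this]
  obtain u :: "nat \<Rightarrow> ennreal" where u: "range u \<subseteq> ?S" "Sup ?S = (SUP i. u i)" by blast
  have "AE x in M. \<forall>i. u i \<le> f x" unfolding AE_all_countable using u(1) by auto
  thus ?thesis
    unfolding essinf_eq_AE[OF f] u(2) by eventually_elim (auto intro: SUP_least)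
qed

lemma essinf_I:
  fixes f :: "'a \<Rightarrow> ennreal"
  assumes "f \<in> borel_measurable M" "AE x in M. c \<le> f x"
  shows "c \<le> essinf M f"
  unfolding essinf_eq_AE[OF assms(1)] using assms(2) by (intro Sup_upper) simp

lemma hhat_ennreal_measurable [measurable]:
  assumes "\<beta> > 0"
  shows "(\<lambda>\<xi>. ennreal \<bar>hhat \<alpha> \<beta> w \<xi>\<bar>) \<in> borel_measurable lborel"
  using hhat_measurable[OF assms, of \<alpha> w, measurable] by measurable

section \<open>Square integrable functions and the generators\<close>

lemma L2_sq_nrm:
  assumes "f \<in> L2"
  shows "ennreal ((L2_nrm f)\<^sup>2) = (\<integral>\<^sup>+t. ennreal ((norm (f t))\<^sup>2) \<partial>lborel)"
  using assms unfolding L2_def L2_nrm_def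
  by (subst nn_integral_eq_integral) (auto intro!: Bochner_Integration.integral_nonneg)

text \<open>Modulation does not change the modulus, and an affine substitution turns its square into
  a multiple of 1/(1 + x^2).\<close>

lemma cauchy_gabor_square_integrable:
  assumes w: "w > 0"
  shows "cauchy_gabor \<alpha> \<beta> w i \<in> L2"
proof -
  obtain m n where i: "i = (m, n)" by (cases i)
  have eq: "(norm (cauchy_gabor \<alpha> \<beta> w i t))\<^sup>2 = 1 / w\<^sup>2 * inverse (1 + (- (\<alpha> * of_int m / w) + 1 / w * t)\<^sup>2)" for t
  proof -
    have "norm (exp (2 * of_real pi * \<i> * of_real \<beta> * of_int n * of_real t :: complex)) = 1"
      by (simp add: norm_exp_eq_Re)
    moreover have "(norm (complex_of_real t - of_real \<alpha> * of_int m - \<i> * of_real w))\<^sup>2 = (t - \<alpha> * of_int m)\<^sup>2 + w\<^sup>2"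
      by (simp add: cmod_power2)
    ultimately have "(norm (cauchy_gabor \<alpha> \<beta> w i t))\<^sup>2 = 1 / ((t - \<alpha> * of_int m)\<^sup>2 + w\<^sup>2)"
      by (simp add: i cauchy_gabor_def norm_divide power_divide)
    also have "(t - \<alpha> * of_int m)\<^sup>2 + w\<^sup>2 = w\<^sup>2 * (1 + (- (\<alpha> * of_int m / w) + 1 / w * t)\<^sup>2)"
      using w by (simp add: field_simps power2_eq_square)
    finally show ?thesis by (simp add: divide_inverse)
  qed
  have "integrable lborel (\<lambda>x::real. inverse (1 + x\<^sup>2))"
    using integrable_inverse_1_plus_square by (simp add: set_integrable_def)
  from lborel_integrable_real_affine[OF this, of "1 / w" "- (\<alpha> * of_int m / w)"] w
  have "integrable lborel (\<lambda>t. (norm (cauchy_gabor \<alpha> \<beta> w i t))\<^sup>2)"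
    unfolding eq by (intro integrable_mult_right) simp
  moreover have "cauchy_gabor \<alpha> \<beta> w i \<in> borel_measurable lborel"
    unfolding i cauchy_gabor_def by simp measurable
  ultimately show ?thesis by (simp add: L2_def)
qed

lemma L2_mult_integrable:
  assumes "f \<in> L2" "g \<in> L2"
  shows "integrable lborel (\<lambda>t. f t * cnj (g t))"
proof (rule Bochner_Integration.integrable_bound)
  have [measurable]: "f \<in> borel_measurable borel" "g \<in> borel_measurable borel"
    using assms by (auto simp: L2_def)
  show "integrable lborel (\<lambda>t. (norm (f t))\<^sup>2 + (norm (g t))\<^sup>2)"
    using assms by (auto simp: L2_def)
  show "(\<lambda>t. f t * cnj (g t)) \<in> borel_measurable lborel" by measurable
  show "AE t in lborel. norm (f t * cnj (g t)) \<le> norm ((norm (f t))\<^sup>2 + (norm (g t))\<^sup>2)"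
  proof (rule AE_I2)
    fix t
    have "2 * norm (f t) * norm (g t) \<le> (norm (f t))\<^sup>2 + (norm (g t))\<^sup>2" by (rule sum_squares_bound)
    moreover have "0 \<le> norm (f t) * norm (g t)" by simp
    ultimately show "norm (f t * cnj (g t)) \<le> norm ((norm (f t))\<^sup>2 + (norm (g t))\<^sup>2)"
      unfolding norm_mult complex_mod_cnj real_norm_def by linarith
  qed
qed

section \<open>Reduction to bounded functions with bounded support\<close>

lemma nn_norm_times_sine_factor:
  fixes F :: "real \<Rightarrow> complex"
  assumes [measurable]: "F \<in> borel_measurable borel"
  shows "ennreal ((exp (pi * w / \<alpha>) - exp (- (pi * w / \<alpha>)))\<^sup>2 / 4) * (\<integral>\<^sup>+t. ennreal ((norm (F t))\<^sup>2) \<partial>lborel)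
      \<le> (\<integral>\<^sup>+t. ennreal ((norm (F t * sine_factor \<alpha> w t))\<^sup>2) \<partial>lborel)"
    and "(\<integral>\<^sup>+t. ennreal ((norm (F t * sine_factor \<alpha> w t))\<^sup>2) \<partial>lborel)
      \<le> ennreal ((exp (pi * w / \<alpha>) + exp (- (pi * w / \<alpha>)))\<^sup>2 / 4) * (\<integral>\<^sup>+t. ennreal ((norm (F t))\<^sup>2) \<partial>lborel)"
proof -
  have eq: "ennreal ((norm (F t * sine_factor \<alpha> w t))\<^sup>2)
      = ennreal ((norm (sine_factor \<alpha> w t))\<^sup>2) * ennreal ((norm (F t))\<^sup>2)" for t
    by (simp add: norm_mult power_mult_distrib mult.commute flip: ennreal_mult)
  show "ennreal ((exp (pi * w / \<alpha>) - exp (- (pi * w / \<alpha>)))\<^sup>2 / 4) * (\<integral>\<^sup>+t. ennreal ((norm (F t))\<^sup>2) \<partial>lborel)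
      \<le> (\<integral>\<^sup>+t. ennreal ((norm (F t * sine_factor \<alpha> w t))\<^sup>2) \<partial>lborel)"
    unfolding eq using norm_sine_factor(1)[of w \<alpha>]
    by (subst nn_integral_cmult[symmetric]) (auto intro!: nn_integral_mono mult_right_mono ennreal_leI)
  show "(\<integral>\<^sup>+t. ennreal ((norm (F t * sine_factor \<alpha> w t))\<^sup>2) \<partial>lborel)
      \<le> ennreal ((exp (pi * w / \<alpha>) + exp (- (pi * w / \<alpha>)))\<^sup>2 / 4) * (\<integral>\<^sup>+t. ennreal ((norm (F t))\<^sup>2) \<partial>lborel)"
    unfolding eq using norm_sine_factor(2)[of \<alpha> w]
    by (subst nn_integral_cmult[symmetric]) (auto intro!: nn_integral_mono mult_right_mono ennreal_leI)
qed

lemma ennreal_le_divide_iff: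
  fixes x y :: ennreal
  assumes "c > 0"
  shows "x \<le> y / ennreal c \<longleftrightarrow> ennreal c * x \<le> y"
proof -
  have "ennreal c * (y / ennreal c) = y"
    using assms by (simp add: ennreal_times_divide mult.commute ennreal_mult_divide_eq)
  moreover have "x \<le> y / ennreal c \<longleftrightarrow> ennreal c * x \<le> ennreal c * (y / ennreal c)"
    using assms by (subst ennreal_mult_le_mult_iff) auto
  ultimately show ?thesis by simp
qed

lemma ennreal_divide_le_iff:
  fixes x y :: ennreal
  assumes "c > 0"
  shows "y / ennreal c \<le> x \<longleftrightarrow> y \<le> ennreal c * x"
proof -
  have "ennreal c * (y / ennreal c) = y"
    using assms by (simp add: ennreal_times_divide mult.commute ennreal_mult_divide_eq)
  moreover have "y / ennreal c \<le> x \<longleftrightarrow> ennreal c * (y / ennreal c) \<le> ennreal c * x"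
    using assms by (subst ennreal_mult_le_mult_iff) auto
  ultimately show ?thesis by simp
qed

text \<open>The quotient F = f/\<sigma> is bounded with bounded support because |\<sigma>| stays
  away from 0, so the exact formula and Plancherel both apply. The upper estimate needs the norm of
  F bounded above by that of f, hence the minimum of the hyperbolic bounds; the lower estimate needs
  the opposite comparison, hence the maximum.\<close>

lemma frame_sum_bounded_support:
  fixes f :: "real \<Rightarrow> complex"
  assumes \<alpha>: "\<alpha> > 0" and \<beta>: "\<beta> > 0" and w: "w > 0"
    and [measurable]: "f \<in> borel_measurable borel" and bdd: "\<And>x. norm (f x) \<le> C"
    and supp: "\<And>x. x \<notin> {-R..R} \<Longrightarrow> f x = 0"
  defines "N \<equiv> \<integral>\<^sup>+t. ennreal ((norm (f t))\<^sup>2) \<partial>lborel"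
  shows "frame_sum (cauchy_gabor \<alpha> \<beta> w) f \<le> ennreal (pi / \<alpha>) * esssup lborel (\<lambda>\<xi>. ennreal \<bar>hhat \<alpha> \<beta> w \<xi>\<bar>)
           / ennreal ((exp (pi * w / \<alpha>) - exp (- (pi * w / \<alpha>)))\<^sup>2 / 4) * N"
    and "ennreal (pi / \<alpha>) * essinf lborel (\<lambda>\<xi>. ennreal \<bar>hhat \<alpha> \<beta> w \<xi>\<bar>)
           / ennreal ((exp (pi * w / \<alpha>) + exp (- (pi * w / \<alpha>)))\<^sup>2 / 4) * N \<le> frame_sum (cauchy_gabor \<alpha> \<beta> w) f"
proof -
  define S where "S = (exp (pi * w / \<alpha>) - exp (- (pi * w / \<alpha>)))\<^sup>2 / 4"
  define T where "T = (exp (pi * w / \<alpha>) + exp (- (pi * w / \<alpha>)))\<^sup>2 / 4"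
  have S: "S > 0" using \<alpha> w by (simp add: S_def)
  have "exp (pi * w / \<alpha>) + exp (- (pi * w / \<alpha>)) > 0" by (simp add: add_pos_pos)
  hence T: "T > 0" by (simp add: T_def)
  have sf: "norm (sine_factor \<alpha> w t) \<ge> sqrt S" for t
    using norm_sine_factor(1)[of w \<alpha> t] unfolding S_def[symmetric] by (simp add: real_le_lsqrt)
  hence nz: "sine_factor \<alpha> w t \<noteq> 0" for t
    using S by (metis norm_zero not_less real_sqrt_gt_zero)
  define F where "F t = f t / sine_factor \<alpha> w t" for t
  have [measurable]: "F \<in> borel_measurable borel" unfolding F_def by measurable
  have f_eq: "f = (\<lambda>t. F t * sine_factor \<alpha> w t)" using nz by (simp add: F_def)
  have F_bdd: "norm (F t) \<le> C / sqrt S" for t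
    unfolding F_def norm_divide using bdd[of t] sf[of t] S order.trans[OF norm_ge_zero bdd[of t]] by (intro frac_le) auto
  have F_supp: "F t = 0" if "t \<notin> {-R..R}" for t using supp[OF that] by (simp add: F_def)
  have F_int: "integrable lborel F"
    by (rule integrable_bounded_support[OF _ F_bdd F_supp]) auto
  define h where "h \<xi> = ennreal \<bar>hhat \<alpha> \<beta> w \<xi>\<bar>" for \<xi>
  have [measurable]: "h \<in> borel_measurable lborel"
    unfolding h_def by (rule hhat_ennreal_measurable[OF \<beta>])
  have h_eq: "ennreal (hhat \<alpha> \<beta> w \<xi>) = h \<xi>" for \<xi> using hhat_nn(2)[OF \<beta>] by (simp add: h_def)
  define NF where "NF = (\<integral>\<^sup>+t. ennreal ((norm (F t))\<^sup>2) \<partial>lborel)"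
  have N: "ennreal S * NF \<le> N" "N \<le> ennreal T * NF"
    unfolding N_def NF_def S_def T_def f_eq by (rule nn_norm_times_sine_factor; measurable)+
  have planch: "(\<integral>\<^sup>+\<xi>. ennreal ((norm (fourier F \<xi>))\<^sup>2) \<partial>lborel) = NF"
    unfolding NF_def
  proof (rule plancherel_bounded_support)
    \<comment> \<open>Plancherel asks for a support interval of positive length starting at -R; this
      length is positive and reaches past R whatever the sign of R.\<close>
    show "0 < 2 * \<bar>R\<bar> + 1" by simp
    show "t \<notin> {-R..-R + (2 * \<bar>R\<bar> + 1)} \<Longrightarrow> F t = 0" for t by (rule F_supp) auto
  qed (use F_bdd in auto)
  have fs: "frame_sum (cauchy_gabor \<alpha> \<beta> w) f
      = ennreal (pi / \<alpha>) * (\<integral>\<^sup>+\<xi>. h \<xi> * ennreal ((norm (fourier F \<xi>))\<^sup>2) \<partial>lborel)"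
    unfolding f_eq h_eq[symmetric] by (rule frame_sum_cauchy_gabor[OF \<alpha> \<beta> w F_int])
  have "(\<integral>\<^sup>+\<xi>. h \<xi> * ennreal ((norm (fourier F \<xi>))\<^sup>2) \<partial>lborel)
      \<le> (\<integral>\<^sup>+\<xi>. esssup lborel h * ennreal ((norm (fourier F \<xi>))\<^sup>2) \<partial>lborel)"
    using esssup_AE[where f = h and M = lborel]
    by (intro nn_integral_mono_AE) (auto elim!: eventually_mono intro: mult_right_mono)
  also have "\<dots> = esssup lborel h * NF" unfolding planch[symmetric] by (rule nn_integral_cmult) measurable
  finally have "ennreal S * frame_sum (cauchy_gabor \<alpha> \<beta> w) f \<le> ennreal S * (ennreal (pi / \<alpha>) * (esssup lborel h * NF))"
    unfolding fs by (intro mult_left_mono) auto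
  also have "\<dots> = ennreal (pi / \<alpha>) * esssup lborel h * (ennreal S * NF)" by (simp add: mult_ac)
  also have "\<dots> \<le> ennreal (pi / \<alpha>) * esssup lborel h * N" by (intro mult_left_mono N) auto
  finally have "frame_sum (cauchy_gabor \<alpha> \<beta> w) f \<le> ennreal (pi / \<alpha>) * esssup lborel h * N / ennreal S"
    by (simp add: ennreal_le_divide_iff[OF S])
  thus "frame_sum (cauchy_gabor \<alpha> \<beta> w) f \<le> ennreal (pi / \<alpha>) * esssup lborel (\<lambda>\<xi>. ennreal \<bar>hhat \<alpha> \<beta> w \<xi>\<bar>)
           / ennreal ((exp (pi * w / \<alpha>) - exp (- (pi * w / \<alpha>)))\<^sup>2 / 4) * N"
    unfolding S_def[symmetric] h_def[symmetric] by (simp add: divide_ennreal_def mult_ac)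
  have "(\<integral>\<^sup>+\<xi>. essinf lborel h * ennreal ((norm (fourier F \<xi>))\<^sup>2) \<partial>lborel) \<le> (\<integral>\<^sup>+\<xi>. h \<xi> * ennreal ((norm (fourier F \<xi>))\<^sup>2) \<partial>lborel)"
    using essinf_AE[where f = h and M = lborel]
    by (intro nn_integral_mono_AE) (auto elim!: eventually_mono intro: mult_right_mono)
  moreover have "(\<integral>\<^sup>+\<xi>. essinf lborel h * ennreal ((norm (fourier F \<xi>))\<^sup>2) \<partial>lborel) = essinf lborel h * NF"
    unfolding planch[symmetric] by (rule nn_integral_cmult) measurable
  ultimately have low: "ennreal (pi / \<alpha>) * (essinf lborel h * NF) \<le> frame_sum (cauchy_gabor \<alpha> \<beta> w) f"
    unfolding fs by (intro mult_left_mono) auto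
  have "ennreal (pi / \<alpha>) * essinf lborel h * N \<le> ennreal (pi / \<alpha>) * essinf lborel h * (ennreal T * NF)"
    by (intro mult_left_mono N) auto
  also have "\<dots> = ennreal T * (ennreal (pi / \<alpha>) * (essinf lborel h * NF))" by (simp add: mult_ac)
  also have "\<dots> \<le> ennreal T * frame_sum (cauchy_gabor \<alpha> \<beta> w) f" by (intro mult_left_mono low) auto
  finally have "ennreal (pi / \<alpha>) * essinf lborel h * N / ennreal T \<le> frame_sum (cauchy_gabor \<alpha> \<beta> w) f"
    by (simp add: ennreal_divide_le_iff[OF T])
  thus "ennreal (pi / \<alpha>) * essinf lborel (\<lambda>\<xi>. ennreal \<bar>hhat \<alpha> \<beta> w \<xi>\<bar>)
           / ennreal ((exp (pi * w / \<alpha>) + exp (- (pi * w / \<alpha>)))\<^sup>2 / 4) * N \<le> frame_sum (cauchy_gabor \<alpha> \<beta> w) f"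
    unfolding T_def[symmetric] h_def[symmetric] by (simp add: divide_ennreal_def mult_ac)
qed

text \<open>Cutting off in the argument and in height at once makes the result bounded with bounded
  support, while it and the error both remain dominated by f.\<close>

definition truncate :: "nat \<Rightarrow> (real \<Rightarrow> complex) \<Rightarrow> real \<Rightarrow> complex" where
  "truncate n f t = (if \<bar>t\<bar> \<le> n \<and> norm (f t) \<le> n then f t else 0)"

lemma truncate_measurable [measurable]:
  assumes [measurable]: "f \<in> borel_measurable borel"
  shows "truncate n f \<in> borel_measurable borel"
proof -
  have "truncate n f = (\<lambda>t::real. if \<bar>t\<bar> \<le> real n \<and> norm (f t) \<le> real n then f t else 0)"
    by (simp add: truncate_def fun_eq_iff)
  thus ?thesis by simp
qed

lemma truncate_bounded: "norm (truncate n f t) \<le> n" "t \<notin> {- real n..real n} \<Longrightarrow> truncate n f t = 0"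
  "norm (truncate n f t) \<le> norm (f t)" "norm (f t - truncate n f t) \<le> norm (f t)"
  by (auto simp: truncate_def abs_le_iff)

lemma truncate_tendsto: "(\<lambda>n. truncate n f t) \<longlonglongrightarrow> f t"
proof (rule tendsto_eventually)
  obtain n0 :: nat where n0: "max \<bar>t\<bar> (norm (f t)) \<le> n0" using real_arch_simple by blast
  show "eventually (\<lambda>n. truncate n f t = f t) sequentially"
    using eventually_ge_at_top[of n0]
  proof eventually_elim
    case (elim n)
    hence "real n0 \<le> real n" by simp
    hence "\<bar>t\<bar> \<le> n" "norm (f t) \<le> n" using n0 by auto
    thus ?case by (simp add: truncate_def)
  qed
qed

lemma L2_dominated:
  assumes "f \<in> L2" "g \<in> borel_measurable borel" "\<And>t. norm (g t) \<le> norm (f t)"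
  shows "g \<in> L2"
proof -
  note [measurable] = assms(2)
  have "integrable lborel (\<lambda>t. (norm (f t))\<^sup>2)" using assms(1) by (simp add: L2_def)
  hence "integrable lborel (\<lambda>t. (norm (g t))\<^sup>2)"
    by (rule Bochner_Integration.integrable_bound) (auto intro!: AE_I2 power_mono assms(3))
  thus ?thesis using assms(2) by (simp add: L2_def)
qed

lemma nn_norm_finite: "f \<in> L2 \<Longrightarrow> (\<integral>\<^sup>+t. ennreal ((norm (f t))\<^sup>2) \<partial>lborel) < \<infinity>"
  by (subst L2_sq_nrm[symmetric]) auto

lemma nn_norm_truncate_diff:
  assumes f: "f \<in> L2"
  shows "(\<lambda>n. \<integral>\<^sup>+t. ennreal ((norm (truncate n f t - f t))\<^sup>2) \<partial>lborel) \<longlonglongrightarrow> 0"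
    and "(\<lambda>n. \<integral>\<^sup>+t. ennreal ((norm (truncate n f t))\<^sup>2) \<partial>lborel) \<longlonglongrightarrow> (\<integral>\<^sup>+t. ennreal ((norm (f t))\<^sup>2) \<partial>lborel)"
proof -
  have [measurable]: "f \<in> borel_measurable borel" using f by (simp add: L2_def)
  have "(\<lambda>n. \<integral>\<^sup>+t. ennreal ((norm (truncate n f t - f t))\<^sup>2) \<partial>lborel) \<longlonglongrightarrow> (\<integral>\<^sup>+(t::real). 0 \<partial>lborel)"
  proof (rule nn_integral_dominated_convergence[where w = "\<lambda>t. ennreal ((norm (f t))\<^sup>2)"])
    show "AE t in lborel. (\<lambda>n. ennreal ((norm (truncate n f t - f t))\<^sup>2)) \<longlonglongrightarrow> 0"
    proof (rule AE_I2)
      fix t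
      have "(\<lambda>n. ennreal ((norm (truncate n f t - f t))\<^sup>2)) \<longlonglongrightarrow> ennreal ((norm (f t - f t))\<^sup>2)"
        by (intro tendsto_intros truncate_tendsto)
      thus "(\<lambda>n. ennreal ((norm (truncate n f t - f t))\<^sup>2)) \<longlonglongrightarrow> 0" by simp
    qed
    show "AE t in lborel. ennreal ((norm (truncate n f t - f t))\<^sup>2) \<le> ennreal ((norm (f t))\<^sup>2)" for n
      using truncate_bounded(4)[of f _ n] by (intro AE_I2 ennreal_leI power_mono) (auto simp: norm_minus_commute)
  qed (use nn_norm_finite[OF f] in auto)
  thus "(\<lambda>n. \<integral>\<^sup>+t. ennreal ((norm (truncate n f t - f t))\<^sup>2) \<partial>lborel) \<longlonglongrightarrow> 0" by simp
  show "(\<lambda>n. \<integral>\<^sup>+t. ennreal ((norm (truncate n f t))\<^sup>2) \<partial>lborel) \<longlonglongrightarrow> (\<integral>\<^sup>+t. ennreal ((norm (f t))\<^sup>2) \<partial>lborel)"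
  proof (rule nn_integral_dominated_convergence[where w = "\<lambda>t. ennreal ((norm (f t))\<^sup>2)"])
    show "AE t in lborel. (\<lambda>n. ennreal ((norm (truncate n f t))\<^sup>2)) \<longlonglongrightarrow> ennreal ((norm (f t))\<^sup>2)"
      by (intro AE_I2 tendsto_intros truncate_tendsto)
    show "AE t in lborel. ennreal ((norm (truncate n f t))\<^sup>2) \<le> ennreal ((norm (f t))\<^sup>2)" for n
      using truncate_bounded(3)[of n f] by (intro AE_I2 ennreal_leI power_mono) auto
  qed (use nn_norm_finite[OF f] in auto)
qed

lemma L2_inner_truncate_tendsto:
  assumes f: "f \<in> L2" and g: "g \<in> L2"
  shows "(\<lambda>n. L2_inner (truncate n f) g) \<longlonglongrightarrow> L2_inner f g"
proof -
  have [measurable]: "f \<in> borel_measurable borel" "g \<in> borel_measurable borel"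
    using f g by (simp_all add: L2_def)
  show ?thesis unfolding L2_inner_def
  proof (rule integral_dominated_convergence[where w = "\<lambda>t. norm (f t * cnj (g t))"])
    show "integrable lborel (\<lambda>t. norm (f t * cnj (g t)))"
      using L2_mult_integrable[OF f g] by (rule integrable_norm)
    show "AE t in lborel. (\<lambda>n. truncate n f t * cnj (g t)) \<longlonglongrightarrow> f t * cnj (g t)"
      by (intro AE_I2 tendsto_intros truncate_tendsto)
    show "AE t in lborel. norm (truncate n f t * cnj (g t)) \<le> norm (f t * cnj (g t))" for n
      unfolding norm_mult by (intro AE_I2 mult_right_mono truncate_bounded) simp
  qed measurable
qed

text \<open>Each coefficient converges by dominated convergence, and Fatou for the counting measure
  carries this over to the sum without any uniformity in the index.\<close>

lemma frame_sum_le_truncate: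
  fixes G :: "'i::countable \<Rightarrow> real \<Rightarrow> complex"
  assumes f: "f \<in> L2" and G: "\<And>i. G i \<in> L2"
  shows "frame_sum G f \<le> liminf (\<lambda>n. frame_sum G (truncate n f))"
proof -
  have lim: "(\<lambda>n. ennreal ((norm (L2_inner (truncate n f) (G i)))\<^sup>2)) \<longlonglongrightarrow> ennreal ((norm (L2_inner f (G i)))\<^sup>2)" for i
    by (intro tendsto_intros L2_inner_truncate_tendsto f G)
  have "ennreal ((norm (L2_inner f (G i)))\<^sup>2) = liminf (\<lambda>n. ennreal ((norm (L2_inner (truncate n f) (G i)))\<^sup>2))" for i
    by (rule lim_imp_Liminf[OF _ lim, symmetric]) simp
  hence "frame_sum G f = (\<integral>\<^sup>+i. liminf (\<lambda>n. ennreal ((norm (L2_inner (truncate n f) (G i)))\<^sup>2)) \<partial>count_space UNIV)"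
    unfolding frame_sum_def infsum_eq_nn_integral_count_space by simp
  also have "\<dots> \<le> liminf (\<lambda>n. \<integral>\<^sup>+i. ennreal ((norm (L2_inner (truncate n f) (G i)))\<^sup>2) \<partial>count_space UNIV)"
    by (rule nn_integral_liminf) simp
  finally show ?thesis unfolding frame_sum_def infsum_eq_nn_integral_count_space .
qed

text \<open>Fatou bounds the frame sum of f by the limit inferior over truncations, and the squared
  norms of these converge. Finiteness of B makes multiplication by B continuous on the extended
  nonnegative reals.\<close>

lemma upper_frame_bound_from_bounded_support:
  fixes G :: "'i::countable \<Rightarrow> real \<Rightarrow> complex"
  assumes G: "\<And>i. G i \<in> L2" and B: "B < \<infinity>"
    and bd: "\<And>n f. f \<in> L2 \<Longrightarrow> frame_sum G (truncate n f) \<le> B * (\<integral>\<^sup>+t. ennreal ((norm (truncate n f t))\<^sup>2) \<partial>lborel)"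
  shows "upper_frame_bound G B"
  unfolding upper_frame_bound_def
proof
  fix f assume f: "f \<in> L2"
  have "frame_sum G f \<le> liminf (\<lambda>n. frame_sum G (truncate n f))" by (rule frame_sum_le_truncate[OF f G])
  also have "\<dots> \<le> liminf (\<lambda>n. B * (\<integral>\<^sup>+t. ennreal ((norm (truncate n f t))\<^sup>2) \<partial>lborel))"
    by (intro Liminf_mono always_eventually allI bd f)
  also have "\<dots> = B * (\<integral>\<^sup>+t. ennreal ((norm (f t))\<^sup>2) \<partial>lborel)"
    using B by (intro lim_imp_Liminf ennreal_tendsto_cmult nn_norm_truncate_diff f) auto
  finally show "frame_sum G f \<le> B * ennreal ((L2_nrm f)\<^sup>2)" by (simp add: L2_sq_nrm[OF f])
qed

text \<open>This is 2|a||b| <= e|a|^2 + |b|^2/e. The free parameter keeps the factor of the main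
  term as close to 1 as desired; fixing e = 1 would cost a factor 2 in the lower frame
  bound.\<close>

lemma norm_add_square_le:
  fixes a b :: complex
  assumes "e > 0"
  shows "(norm (a + b))\<^sup>2 \<le> (1 + e) * (norm a)\<^sup>2 + (1 + 1 / e) * (norm b)\<^sup>2"
proof -
  have "(norm (a + b))\<^sup>2 \<le> (norm a + norm b)\<^sup>2" by (intro power_mono norm_triangle_ineq) simp
  moreover have "0 \<le> (e * norm a - norm b)\<^sup>2 / e" using assms by simp
  moreover have "(e * norm a - norm b)\<^sup>2 / e = e * (norm a)\<^sup>2 - 2 * norm a * norm b + (norm b)\<^sup>2 / e"
    using assms by (simp add: power2_diff power_mult_distrib field_simps) (simp add: power2_eq_square)
  ultimately show ?thesis by (simp add: power2_sum algebra_simps)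
qed

lemma frame_sum_add_le:
  fixes G :: "'i::countable \<Rightarrow> real \<Rightarrow> complex"
  assumes f: "f \<in> L2" and g: "g \<in> L2" and G: "\<And>i. G i \<in> L2" and e: "e > 0"
  shows "frame_sum G (\<lambda>t. f t + g t) \<le> ennreal (1 + e) * frame_sum G f + ennreal (1 + 1 / e) * frame_sum G g"
proof -
  have "L2_inner (\<lambda>t. f t + g t) (G i) = L2_inner f (G i) + L2_inner g (G i)" for i
    unfolding L2_inner_def using L2_mult_integrable[OF f G] L2_mult_integrable[OF g G]
    by (simp add: distrib_right)
  hence "frame_sum G (\<lambda>t. f t + g t) \<le> (\<integral>\<^sup>+i. ennreal (1 + e) * ennreal ((norm (L2_inner f (G i)))\<^sup>2)
      + ennreal (1 + 1 / e) * ennreal ((norm (L2_inner g (G i)))\<^sup>2) \<partial>count_space UNIV)"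
    unfolding frame_sum_def infsum_eq_nn_integral_count_space
    using norm_add_square_le[OF e] e
    by (intro nn_integral_mono) (auto simp flip: ennreal_mult ennreal_plus intro!: ennreal_leI)
  also have "\<dots> = ennreal (1 + e) * frame_sum G f + ennreal (1 + 1 / e) * frame_sum G g"
    unfolding frame_sum_def infsum_eq_nn_integral_count_space
    by (simp add: nn_integral_add nn_integral_cmult)
  finally show ?thesis .
qed

text \<open>A lower bound on a dense set extends only because the finite upper bound controls the frame sum
  of the truncation error.\<close>

lemma lower_frame_bound_from_bounded_support:
  fixes G :: "'i::countable \<Rightarrow> real \<Rightarrow> complex"
  assumes G: "\<And>i. G i \<in> L2" and B: "B < \<infinity>" "upper_frame_bound G B" and A: "A < \<infinity>"
    and bd: "\<And>n f. f \<in> L2 \<Longrightarrow> A * (\<integral>\<^sup>+t. ennreal ((norm (truncate n f t))\<^sup>2) \<partial>lborel) \<le> frame_sum G (truncate n f)"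
  shows "lower_frame_bound G A"
  unfolding lower_frame_bound_def
proof
  fix f assume f: "f \<in> L2"
  have [measurable]: "f \<in> borel_measurable borel" using f by (simp add: L2_def)
  let ?N = "\<lambda>f. \<integral>\<^sup>+t. ennreal ((norm (f t))\<^sup>2) \<partial>lborel"
  \<comment> \<open>The order of the limits matters: for fixed e the truncation error tends to 0 and
    absorbs its large factor 1 + 1/e; only afterwards does e tend to 0.\<close>
  have step: "A * ?N f \<le> ennreal (1 + e) * frame_sum G f" if e: "e > 0" for e
  proof (rule LIMSEQ_le)
    show "(\<lambda>n. A * ?N (truncate n f)) \<longlonglongrightarrow> A * ?N f"
      using A by (intro ennreal_tendsto_cmult nn_norm_truncate_diff f) auto
    have "(\<lambda>n. ennreal (1 + 1 / e) * B * ?N (\<lambda>t. truncate n f t - f t)) \<longlonglongrightarrow> ennreal (1 + 1 / e) * B * 0"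
      using B(1) by (intro ennreal_tendsto_cmult nn_norm_truncate_diff f) (auto simp: ennreal_mult_less_top)
    hence "(\<lambda>n. ennreal (1 + e) * frame_sum G f + ennreal (1 + 1 / e) * B * ?N (\<lambda>t. truncate n f t - f t))
        \<longlonglongrightarrow> ennreal (1 + e) * frame_sum G f + ennreal (1 + 1 / e) * B * 0"
      by (intro tendsto_add tendsto_const)
    thus "(\<lambda>n. ennreal (1 + e) * frame_sum G f + ennreal (1 + 1 / e) * B * ?N (\<lambda>t. truncate n f t - f t))
        \<longlonglongrightarrow> ennreal (1 + e) * frame_sum G f" by simp
    have "A * ?N (truncate n f) \<le> ennreal (1 + e) * frame_sum G f + ennreal (1 + 1 / e) * B * ?N (\<lambda>t. truncate n f t - f t)" for n
    proof -
      have d: "(\<lambda>t. truncate n f t - f t) \<in> L2"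
        using truncate_bounded(4)[of f _ n] by (intro L2_dominated[OF f]) (auto simp: norm_minus_commute)
      have "A * ?N (truncate n f) \<le> frame_sum G (\<lambda>t. f t + (truncate n f t - f t))"
        using bd[OF f, of n] by simp
      also have "\<dots> \<le> ennreal (1 + e) * frame_sum G f + ennreal (1 + 1 / e) * frame_sum G (\<lambda>t. truncate n f t - f t)"
        by (rule frame_sum_add_le[OF f d G e])
      also have "frame_sum G (\<lambda>t. truncate n f t - f t) \<le> B * ?N (\<lambda>t. truncate n f t - f t)"
        using B(2) d unfolding upper_frame_bound_def by (simp add: L2_sq_nrm[symmetric])
      finally show ?thesis by (simp add: mult.assoc add_left_mono mult_left_mono)
    qed
    thus "\<exists>N. \<forall>n\<ge>N. A * ?N (truncate n f) \<le> ennreal (1 + e) * frame_sum G f + ennreal (1 + 1 / e) * B * ?N (\<lambda>t. truncate n f t - f t)"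
      by blast
  qed
  have "A * ?N f \<le> frame_sum G f"
  proof (rule ennreal_le_epsilon)
    fix e :: real assume "frame_sum G f < top" "e > 0"
    then obtain s where s: "s \<ge> 0" "frame_sum G f = ennreal s" by (cases "frame_sum G f") auto
    \<comment> \<open>With e / (s + 1) in place of e the excess over s is at most e; the added 1
      covers s = 0.\<close>
    have "A * ?N f \<le> ennreal (1 + e / (s + 1)) * ennreal s"
      using step[of "e / (s + 1)"] s \<open>e > 0\<close> by simp
    also have "\<dots> = ennreal (s + e * (s / (s + 1)))"
      using s \<open>e > 0\<close> by (simp add: algebra_simps flip: ennreal_mult)
    also have "\<dots> \<le> ennreal (s + e)"
      using s \<open>e > 0\<close> by (intro ennreal_leI add_left_mono mult_left_le) auto
    finally show "A * ?N f \<le> frame_sum G f + ennreal e" using s \<open>e > 0\<close> by simp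
  qed
  thus "A * ennreal ((L2_nrm f)\<^sup>2) \<le> frame_sum G f" by (simp add: L2_sq_nrm[OF f])
qed

section \<open>Gaussian test functions\<close>

lemma std_normal_fourier:
  "(LINT x|lborel. of_real (std_normal_density x) * cis (u * x)) = complex_of_real (exp (- u\<^sup>2 / 2))"
proof -
  have "complex_of_real (exp (- u\<^sup>2 / 2)) = char std_normal_distribution u"
    unfolding char_std_normal_distribution ..
  also have "\<dots> = (LINT x|lborel. std_normal_density x *\<^sub>R iexp (u * x))"
    unfolding char_def by (subst integral_density) auto
  finally show ?thesis by (simp add: cis_conv_exp scaleR_conv_of_real)
qed

text \<open>Modulation centres the transform at x0, and dilation by s narrows it to the scale 1/(2
  pi s), so large s localises at x0.\<close>

lemma fourier_modulated_gaussian: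
  assumes s: "s > 0"
  shows "fourier (\<lambda>t. of_real (std_normal_density (t / s)) * cis (2 * pi * x0 * t)) \<xi>
    = of_real (s * exp (- (2 * pi * s * (\<xi> - x0))\<^sup>2 / 2))"
proof -
  have "fourier (\<lambda>t. of_real (std_normal_density (t / s)) * cis (2 * pi * x0 * t)) \<xi>
     = (LINT t|lborel. of_real (std_normal_density (t / s)) * cis (2 * pi * (x0 - \<xi>) * t))"
    unfolding fourier_def mult.assoc[of "complex_of_real _"] cis_mult
    by (intro Bochner_Integration.integral_cong refl arg_cong2[of _ _ _ _ "(*)"] arg_cong[of _ _ cis])
       (simp add: algebra_simps)
  also have "\<dots> = \<bar>s\<bar> *\<^sub>R (LINT x|lborel. of_real (std_normal_density ((0 + s * x) / s)) * cis (2 * pi * (x0 - \<xi>) * (0 + s * x)))"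
    using s by (intro lborel_integral_real_affine) simp
  also have "(LINT x|lborel. of_real (std_normal_density ((0 + s * x) / s)) * cis (2 * pi * (x0 - \<xi>) * (0 + s * x)))
     = (LINT x|lborel. of_real (std_normal_density x) * cis ((2 * pi * s * (x0 - \<xi>)) * x))"
    using s by (simp add: mult_ac)
  also have "\<dots> = complex_of_real (exp (- (2 * pi * s * (x0 - \<xi>))\<^sup>2 / 2))" by (rule std_normal_fourier)
  also have "(2 * pi * s * (x0 - \<xi>))\<^sup>2 = (2 * pi * s * (\<xi> - x0))\<^sup>2" by (simp add: power2_eq_square algebra_simps)
  finally show ?thesis using s by (simp add: scaleR_conv_of_real)
qed

lemma nn_integral_gaussian: "(\<integral>\<^sup>+x. ennreal (exp (- x\<^sup>2)) \<partial>lborel) = ennreal (sqrt pi)"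
proof -
  have "has_bochner_integral lborel (\<lambda>x::real. exp (- x\<^sup>2)) (2 *\<^sub>R (sqrt pi / 2))"
    by (rule has_bochner_integral_even_function[OF gaussian_moment_0]) simp
  hence "integrable lborel (\<lambda>x::real. exp (- x\<^sup>2))" "(LINT x|lborel. exp (- (x::real)\<^sup>2)) = sqrt pi"
    by (auto simp: has_bochner_integral_iff)
  thus ?thesis by (subst nn_integral_eq_integral) auto
qed

text \<open>The Gaussian F is integrable, so the exact formula holds for f = F \<sigma> although its
  support is unbounded. The substitution \<xi> = x0 + x/(2 pi s) keeps the Gaussian fixed and moves
  s into \<open>hhat\<close>. The factor s/(2 pi), common to the frame sum and both norm estimates,
  is split off so that it cancels before the limit is taken.\<close>

lemma gaussian_test_function:
  assumes \<alpha>: "\<alpha> > 0" and \<beta>: "\<beta> > 0" and w: "w > 0" and s: "s > 0"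
  defines "S \<equiv> (exp (pi * w / \<alpha>) - exp (- (pi * w / \<alpha>)))\<^sup>2 / 4"
    and "T \<equiv> (exp (pi * w / \<alpha>) + exp (- (pi * w / \<alpha>)))\<^sup>2 / 4"
  obtains f where "f \<in> L2"
    "frame_sum (cauchy_gabor \<alpha> \<beta> w) f = ennreal (s / (2 * pi)) * (ennreal (pi / \<alpha>) *
       (\<integral>\<^sup>+x. ennreal \<bar>hhat \<alpha> \<beta> w (x0 + x / (2 * pi * s))\<bar> * ennreal (exp (- x\<^sup>2)) \<partial>lborel))"
    "ennreal (s / (2 * pi)) * (ennreal S * ennreal (sqrt pi)) \<le> ennreal ((L2_nrm f)\<^sup>2)"
    "ennreal ((L2_nrm f)\<^sup>2) \<le> ennreal (s / (2 * pi)) * (ennreal T * ennreal (sqrt pi))"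
proof -
  define F where "F t = of_real (std_normal_density (t / s)) * cis (2 * pi * x0 * t)" for t
  define f where "f t = F t * sine_factor \<alpha> w t" for t
  have [measurable]: "F \<in> borel_measurable borel" unfolding F_def by measurable
  have [measurable]: "f \<in> borel_measurable borel" unfolding f_def by measurable
  have "integrable lborel std_normal_density" by simp
  from lborel_integrable_real_affine[OF this, of "1 / s" 0] s
  have "integrable lborel (\<lambda>t. std_normal_density (t / s))" by simp
  hence F_int: "integrable lborel F"
    by (rule Bochner_Integration.integrable_bound) (auto simp: F_def norm_mult)
  have "(norm (F t))\<^sup>2 = 1 / (2 * pi) * exp (- (t / s)\<^sup>2)" for t
  proof -
    have "(norm (F t))\<^sup>2 = (std_normal_density (t / s))\<^sup>2" by (simp add: F_def norm_mult)
    also have "\<dots> = 1 / (2 * pi) * (exp (- (t / s)\<^sup>2 / 2))\<^sup>2"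
      by (simp add: std_normal_density_def power_mult_distrib power_divide)
    also have "(exp (- (t / s)\<^sup>2 / 2))\<^sup>2 = exp (- (t / s)\<^sup>2)" by (simp flip: exp_double)
    finally show ?thesis .
  qed
  hence "(\<integral>\<^sup>+t. ennreal ((norm (F t))\<^sup>2) \<partial>lborel) = (\<integral>\<^sup>+t. ennreal (1 / (2 * pi) * exp (- (t / s)\<^sup>2)) \<partial>lborel)"
    by simp
  also have "\<dots> = ennreal \<bar>s\<bar> * (\<integral>\<^sup>+x. ennreal (1 / (2 * pi) * exp (- ((0 + s * x) / s)\<^sup>2)) \<partial>lborel)"
    using s by (intro nn_integral_real_affine) auto
  also have "(\<integral>\<^sup>+x. ennreal (1 / (2 * pi) * exp (- ((0 + s * x) / s)\<^sup>2)) \<partial>lborel)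
      = (\<integral>\<^sup>+x. ennreal (1 / (2 * pi)) * ennreal (exp (- x\<^sup>2)) \<partial>lborel)"
    using s by (subst ennreal_mult[symmetric]) auto
  also have "\<dots> = ennreal (1 / (2 * pi)) * ennreal (sqrt pi)"
    by (subst nn_integral_cmult) (auto simp: nn_integral_gaussian)
  finally have NF: "(\<integral>\<^sup>+t. ennreal ((norm (F t))\<^sup>2) \<partial>lborel) = ennreal (s / (2 * pi)) * ennreal (sqrt pi)"
    using s by (simp add: mult.assoc[symmetric] flip: ennreal_mult)
  have lower: "ennreal S * (ennreal (s / (2 * pi)) * ennreal (sqrt pi)) \<le> (\<integral>\<^sup>+t. ennreal ((norm (f t))\<^sup>2) \<partial>lborel)"
    unfolding S_def NF[symmetric] f_def by (rule nn_norm_times_sine_factor) measurable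
  have upper: "(\<integral>\<^sup>+t. ennreal ((norm (f t))\<^sup>2) \<partial>lborel) \<le> ennreal T * (ennreal (s / (2 * pi)) * ennreal (sqrt pi))"
    unfolding T_def NF[symmetric] f_def by (rule nn_norm_times_sine_factor) measurable
  also have "\<dots> < \<infinity>" by (simp add: ennreal_mult_less_top)
  finally have "integrable lborel (\<lambda>t. (norm (f t))\<^sup>2)"
    by (intro integrableI_bounded) auto
  hence f_L2: "f \<in> L2" by (simp add: L2_def)
  note [measurable] = hhat_ennreal_measurable[OF \<beta>, of \<alpha> w]
  have "frame_sum (cauchy_gabor \<alpha> \<beta> w) f
    = ennreal (pi / \<alpha>) * (\<integral>\<^sup>+\<eta>. ennreal \<bar>hhat \<alpha> \<beta> w \<eta>\<bar> * ennreal ((norm (fourier F \<eta>))\<^sup>2) \<partial>lborel)"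
    unfolding f_def[abs_def] frame_sum_cauchy_gabor[OF \<alpha> \<beta> w F_int]
    using hhat_nn(2)[OF \<beta>] by simp
  also have "(\<integral>\<^sup>+\<eta>. ennreal \<bar>hhat \<alpha> \<beta> w \<eta>\<bar> * ennreal ((norm (fourier F \<eta>))\<^sup>2) \<partial>lborel)
    = ennreal \<bar>1 / (2 * pi * s)\<bar> * (\<integral>\<^sup>+x. ennreal \<bar>hhat \<alpha> \<beta> w (x0 + 1 / (2 * pi * s) * x)\<bar>
         * ennreal ((norm (fourier F (x0 + 1 / (2 * pi * s) * x)))\<^sup>2) \<partial>lborel)"
    using s by (intro nn_integral_real_affine) auto
  also have "(\<integral>\<^sup>+x. ennreal \<bar>hhat \<alpha> \<beta> w (x0 + 1 / (2 * pi * s) * x)\<bar>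
         * ennreal ((norm (fourier F (x0 + 1 / (2 * pi * s) * x)))\<^sup>2) \<partial>lborel)
     = (\<integral>\<^sup>+x. ennreal (s\<^sup>2) * (ennreal \<bar>hhat \<alpha> \<beta> w (x0 + x / (2 * pi * s))\<bar> * ennreal (exp (- x\<^sup>2))) \<partial>lborel)"
  proof (rule nn_integral_cong)
    fix x :: real
    have "fourier F (x0 + 1 / (2 * pi * s) * x) = of_real (s * exp (- x\<^sup>2 / 2))"
      using s unfolding F_def fourier_modulated_gaussian[OF s] by simp
    hence "(norm (fourier F (x0 + 1 / (2 * pi * s) * x)))\<^sup>2 = s\<^sup>2 * (exp (- x\<^sup>2 / 2))\<^sup>2"
      by (simp add: power_mult_distrib norm_mult)
    also have "(exp (- x\<^sup>2 / 2))\<^sup>2 = exp (- x\<^sup>2)" by (simp flip: exp_double)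
    finally show "ennreal \<bar>hhat \<alpha> \<beta> w (x0 + 1 / (2 * pi * s) * x)\<bar>
         * ennreal ((norm (fourier F (x0 + 1 / (2 * pi * s) * x)))\<^sup>2)
       = ennreal (s\<^sup>2) * (ennreal \<bar>hhat \<alpha> \<beta> w (x0 + x / (2 * pi * s))\<bar> * ennreal (exp (- x\<^sup>2)))"
      by (simp add: ennreal_mult mult_ac)
  qed
  also have "\<dots> = ennreal (s\<^sup>2) * (\<integral>\<^sup>+x. ennreal \<bar>hhat \<alpha> \<beta> w (x0 + x / (2 * pi * s))\<bar> * ennreal (exp (- x\<^sup>2)) \<partial>lborel)"
    by (rule nn_integral_cmult) measurable
  finally have fs: "frame_sum (cauchy_gabor \<alpha> \<beta> w) f = ennreal (s / (2 * pi)) * (ennreal (pi / \<alpha>) *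
       (\<integral>\<^sup>+x. ennreal \<bar>hhat \<alpha> \<beta> w (x0 + x / (2 * pi * s))\<bar> * ennreal (exp (- x\<^sup>2)) \<partial>lborel))"
  proof -
    \<comment> \<open>Here s^2 is the height of the squared transform and 1/(2 pi s) the Jacobian of
      the substitution; their product is the factor that also occurs in the squared norm of
      F.\<close>
    have "ennreal \<bar>1 / (2 * pi * s)\<bar> * ennreal (s\<^sup>2) = ennreal (s / (2 * pi))"
      using s by (simp add: power2_eq_square flip: ennreal_mult)
    hence "ennreal (pi / \<alpha>) * (ennreal \<bar>1 / (2 * pi * s)\<bar> * (ennreal (s\<^sup>2) * J)) = ennreal (s / (2 * pi)) * (ennreal (pi / \<alpha>) * J)" for J
      by (metis mult.assoc mult.commute)
    moreover assume "frame_sum (cauchy_gabor \<alpha> \<beta> w) f = ennreal (pi / \<alpha>) * (ennreal \<bar>1 / (2 * pi * s)\<bar> * (ennreal (s\<^sup>2) *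
      (\<integral>\<^sup>+x. ennreal \<bar>hhat \<alpha> \<beta> w (x0 + x / (2 * pi * s))\<bar> * ennreal (exp (- x\<^sup>2)) \<partial>lborel)))"
    ultimately show ?thesis by simp
  qed
  show thesis
  proof (rule that[OF f_L2 fs])
    show "ennreal (s / (2 * pi)) * (ennreal S * ennreal (sqrt pi)) \<le> ennreal ((L2_nrm f)\<^sup>2)"
      using lower by (simp add: L2_sq_nrm[OF f_L2] mult.left_commute)
    show "ennreal ((L2_nrm f)\<^sup>2) \<le> ennreal (s / (2 * pi)) * (ennreal T * ennreal (sqrt pi))"
      using upper by (simp add: L2_sq_nrm[OF f_L2] mult.left_commute)
  qed
qed

text \<open>An approximate identity in rescaled form: the Gaussian stays fixed while the argument of
  h contracts to x0, with K exp(-x^2) as dominating function. \<open>Suc n\<close> keeps the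
  dilation parameter positive.\<close>

lemma gaussian_average_tendsto:
  fixes h :: "real \<Rightarrow> real"
  assumes [measurable]: "h \<in> borel_measurable borel" and K: "\<And>x. \<bar>h x\<bar> \<le> K" and cont: "isCont h x0"
  shows "(\<lambda>n. \<integral>\<^sup>+x. ennreal \<bar>h (x0 + x / (2 * pi * real (Suc n)))\<bar> * ennreal (exp (- x\<^sup>2)) \<partial>lborel)
     \<longlonglongrightarrow> ennreal \<bar>h x0\<bar> * ennreal (sqrt pi)"
proof -
  have K0: "K \<ge> 0" using K[of 0] by linarith
  have "(\<lambda>n. \<integral>\<^sup>+x. ennreal (\<bar>h (x0 + x / (2 * pi * real (Suc n)))\<bar> * exp (- x\<^sup>2)) \<partial>lborel)
     \<longlonglongrightarrow> (\<integral>\<^sup>+x. ennreal (\<bar>h x0\<bar> * exp (- x\<^sup>2)) \<partial>lborel)"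
  proof (rule nn_integral_dominated_convergence[where w = "\<lambda>x. ennreal (K * exp (- x\<^sup>2))"])
    have "(\<integral>\<^sup>+x. ennreal (K * exp (- x\<^sup>2)) \<partial>lborel) = ennreal K * ennreal (sqrt pi)"
      using K0 by (simp add: ennreal_mult nn_integral_cmult nn_integral_gaussian)
    thus "(\<integral>\<^sup>+x. ennreal (K * exp (- x\<^sup>2)) \<partial>lborel) < \<infinity>" by (simp add: ennreal_mult_less_top)
    show "AE x in lborel. ennreal (\<bar>h (x0 + x / (2 * pi * real (Suc n)))\<bar> * exp (- x\<^sup>2)) \<le> ennreal (K * exp (- x\<^sup>2))" for n
      by (intro AE_I2 ennreal_leI mult_right_mono K) simp
    show "AE x in lborel. (\<lambda>n. ennreal (\<bar>h (x0 + x / (2 * pi * real (Suc n)))\<bar> * exp (- x\<^sup>2)))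
        \<longlonglongrightarrow> ennreal (\<bar>h x0\<bar> * exp (- x\<^sup>2))"
    proof (rule AE_I2)
      fix x :: real
      have "(\<lambda>n. x0 + x / (2 * pi) * (1 / real (Suc n))) \<longlonglongrightarrow> x0 + x / (2 * pi) * 0"
        by (intro tendsto_intros LIMSEQ_Suc[OF lim_1_over_n])
      hence "(\<lambda>n. x0 + x / (2 * pi * real (Suc n))) \<longlonglongrightarrow> x0" by simp
      from isCont_tendsto_compose[OF cont this]
      show "(\<lambda>n. ennreal (\<bar>h (x0 + x / (2 * pi * real (Suc n)))\<bar> * exp (- x\<^sup>2))) \<longlonglongrightarrow> ennreal (\<bar>h x0\<bar> * exp (- x\<^sup>2))"
        by (intro tendsto_intros)
    qed
  qed measurable
  thus ?thesis by (simp add: ennreal_mult nn_integral_cmult nn_integral_gaussian)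
qed

text \<open>Test the frame inequality on Gaussians concentrating at x0 and pass to the limit. A
  lower frame bound is exploited through a lower estimate of the norm of f, an upper one through an
  upper estimate; this decides which extreme of |\<sigma>|^2 enters.\<close>

lemma frame_bounds_imp_hhat_bounds:
  assumes \<alpha>: "\<alpha> > 0" and \<beta>: "\<beta> > 0" and w: "w > 0" and cont: "isCont (hhat \<alpha> \<beta> w) x0"
  shows "lower_frame_bound (cauchy_gabor \<alpha> \<beta> w) A \<Longrightarrow>
      A * ennreal ((exp (pi * w / \<alpha>) - exp (- (pi * w / \<alpha>)))\<^sup>2 / 4) \<le> ennreal (pi / \<alpha>) * ennreal \<bar>hhat \<alpha> \<beta> w x0\<bar>"
    and "upper_frame_bound (cauchy_gabor \<alpha> \<beta> w) B \<Longrightarrow>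
      ennreal (pi / \<alpha>) * ennreal \<bar>hhat \<alpha> \<beta> w x0\<bar> \<le> B * ennreal ((exp (pi * w / \<alpha>) + exp (- (pi * w / \<alpha>)))\<^sup>2 / 4)"
proof -
  define S where "S = (exp (pi * w / \<alpha>) - exp (- (pi * w / \<alpha>)))\<^sup>2 / 4"
  define T where "T = (exp (pi * w / \<alpha>) + exp (- (pi * w / \<alpha>)))\<^sup>2 / 4"
  obtain K where "\<And>\<xi>. hhat \<alpha> \<beta> w \<xi> \<le> K" using hhat_bounded[OF \<beta> w] by blast
  hence K: "\<bar>hhat \<alpha> \<beta> w \<xi>\<bar> \<le> K" for \<xi> using hhat_nn(2)[OF \<beta>, of \<alpha> w \<xi>] by simp
  define J where "J n = (\<integral>\<^sup>+x. ennreal \<bar>hhat \<alpha> \<beta> w (x0 + x / (2 * pi * real (Suc n)))\<bar> * ennreal (exp (- x\<^sup>2)) \<partial>lborel)" for n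
  have "J \<longlonglongrightarrow> ennreal \<bar>hhat \<alpha> \<beta> w x0\<bar> * ennreal (sqrt pi)"
    unfolding J_def by (rule gaussian_average_tendsto[OF hhat_measurable[OF \<beta>] K cont])
  hence lim: "(\<lambda>n. ennreal (pi / \<alpha>) * J n) \<longlonglongrightarrow> ennreal (pi / \<alpha>) * (ennreal \<bar>hhat \<alpha> \<beta> w x0\<bar> * ennreal (sqrt pi))"
    by (intro ennreal_tendsto_cmult) auto
  have cancel: "ennreal (sqrt pi) * x \<le> ennreal (sqrt pi) * y \<longleftrightarrow> x \<le> y" for x y
    by (rule ennreal_mult_le_mult_iff) auto
  have cancel_n: "ennreal (real (Suc n) / (2 * pi)) * x \<le> ennreal (real (Suc n) / (2 * pi)) * y \<longleftrightarrow> x \<le> y" for x y n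
    by (rule ennreal_mult_le_mult_iff) auto
  show "A * ennreal ((exp (pi * w / \<alpha>) - exp (- (pi * w / \<alpha>)))\<^sup>2 / 4) \<le> ennreal (pi / \<alpha>) * ennreal \<bar>hhat \<alpha> \<beta> w x0\<bar>"
    if A: "lower_frame_bound (cauchy_gabor \<alpha> \<beta> w) A"
  proof -
    have "A * (ennreal S * ennreal (sqrt pi)) \<le> ennreal (pi / \<alpha>) * J n" for n
    proof -
      obtain f where f: "f \<in> L2"
        "frame_sum (cauchy_gabor \<alpha> \<beta> w) f = ennreal (real (Suc n) / (2 * pi)) * (ennreal (pi / \<alpha>) * J n)"
        "ennreal (real (Suc n) / (2 * pi)) * (ennreal S * ennreal (sqrt pi)) \<le> ennreal ((L2_nrm f)\<^sup>2)"
        unfolding S_def J_def by (rule gaussian_test_function[OF \<alpha> \<beta> w, of "real (Suc n)" x0]) auto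
      have "ennreal (real (Suc n) / (2 * pi)) * (A * (ennreal S * ennreal (sqrt pi)))
        = A * (ennreal (real (Suc n) / (2 * pi)) * (ennreal S * ennreal (sqrt pi)))" by (rule mult.left_commute)
      also have "\<dots> \<le> A * ennreal ((L2_nrm f)\<^sup>2)" by (intro mult_left_mono f) simp
      also have "\<dots> \<le> frame_sum (cauchy_gabor \<alpha> \<beta> w) f" using A f(1) by (simp add: lower_frame_bound_def)
      finally show ?thesis unfolding f(2) cancel_n .
    qed
    hence "A * (ennreal S * ennreal (sqrt pi)) \<le> ennreal (pi / \<alpha>) * (ennreal \<bar>hhat \<alpha> \<beta> w x0\<bar> * ennreal (sqrt pi))"
      by (intro LIMSEQ_le_const[OF lim]) auto
    hence "ennreal (sqrt pi) * (A * ennreal S) \<le> ennreal (sqrt pi) * (ennreal (pi / \<alpha>) * ennreal \<bar>hhat \<alpha> \<beta> w x0\<bar>)"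
      by (simp only: mult_ac)
    thus ?thesis unfolding cancel S_def .
  qed
  show "ennreal (pi / \<alpha>) * ennreal \<bar>hhat \<alpha> \<beta> w x0\<bar> \<le> B * ennreal ((exp (pi * w / \<alpha>) + exp (- (pi * w / \<alpha>)))\<^sup>2 / 4)"
    if B: "upper_frame_bound (cauchy_gabor \<alpha> \<beta> w) B"
  proof -
    have "ennreal (pi / \<alpha>) * J n \<le> B * (ennreal T * ennreal (sqrt pi))" for n
    proof -
      obtain f where f: "f \<in> L2"
        "frame_sum (cauchy_gabor \<alpha> \<beta> w) f = ennreal (real (Suc n) / (2 * pi)) * (ennreal (pi / \<alpha>) * J n)"
        "ennreal ((L2_nrm f)\<^sup>2) \<le> ennreal (real (Suc n) / (2 * pi)) * (ennreal T * ennreal (sqrt pi))"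
        unfolding T_def J_def by (rule gaussian_test_function[OF \<alpha> \<beta> w, of "real (Suc n)" x0]) auto
      have "frame_sum (cauchy_gabor \<alpha> \<beta> w) f \<le> B * ennreal ((L2_nrm f)\<^sup>2)"
        using B f(1) by (simp add: upper_frame_bound_def)
      also have "\<dots> \<le> B * (ennreal (real (Suc n) / (2 * pi)) * (ennreal T * ennreal (sqrt pi)))"
        by (intro mult_left_mono f) simp
      also have "\<dots> = ennreal (real (Suc n) / (2 * pi)) * (B * (ennreal T * ennreal (sqrt pi)))" by (rule mult.left_commute)
      finally show ?thesis unfolding f(2) cancel_n .
    qed
    hence "ennreal (pi / \<alpha>) * (ennreal \<bar>hhat \<alpha> \<beta> w x0\<bar> * ennreal (sqrt pi)) \<le> B * (ennreal T * ennreal (sqrt pi))"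
      by (intro LIMSEQ_le_const2[OF lim]) auto
    hence "ennreal (sqrt pi) * (ennreal (pi / \<alpha>) * ennreal \<bar>hhat \<alpha> \<beta> w x0\<bar>) \<le> ennreal (sqrt pi) * (B * ennreal T)"
      by (simp only: mult_ac)
    thus ?thesis unfolding cancel T_def .
  qed
qed

section \<open>The four estimates for the optimal constants\<close>

lemma ennreal_four_divide:
  assumes "c > 0" "q > 0"
  shows "ennreal (4 * c) * x / ennreal q = ennreal c * x / ennreal (q / 4)"
proof -
  have "ennreal (4 * c) * inverse (ennreal q) = ennreal c * inverse (ennreal (q / 4))"
    using assms by (simp add: inverse_ennreal ennreal_mult[symmetric] field_simps)
  thus ?thesis unfolding divide_ennreal_def by (metis mult.assoc mult.commute)
qed

theorem corollary1p3:
  fixes \<alpha> \<beta> w :: real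
  assumes "w > 0" and "\<alpha> > 0" and "\<beta> > 0" and "\<alpha> * \<beta> \<le> 1"
  shows "ennreal (4 * pi / \<alpha>) * essinf lborel (\<lambda>\<xi>. ennreal \<bar>hhat \<alpha> \<beta> w \<xi>\<bar>)
               / ennreal ((exp (pi * w / \<alpha>) + exp (- (pi * w / \<alpha>)))\<^sup>2)
           \<le> lower_frame_const (cauchy_gabor \<alpha> \<beta> w)
       \<and> lower_frame_const (cauchy_gabor \<alpha> \<beta> w)
           \<le> ennreal (4 * pi / \<alpha>) * essinf lborel (\<lambda>\<xi>. ennreal \<bar>hhat \<alpha> \<beta> w \<xi>\<bar>)
               / ennreal ((exp (pi * w / \<alpha>) - exp (- (pi * w / \<alpha>)))\<^sup>2)
       \<and> ennreal (4 * pi / \<alpha>) * esssup lborel (\<lambda>\<xi>. ennreal \<bar>hhat \<alpha> \<beta> w \<xi>\<bar>)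
               / ennreal ((exp (pi * w / \<alpha>) + exp (- (pi * w / \<alpha>)))\<^sup>2)
           \<le> upper_frame_const (cauchy_gabor \<alpha> \<beta> w)
       \<and> upper_frame_const (cauchy_gabor \<alpha> \<beta> w)
           \<le> ennreal (4 * pi / \<alpha>) * esssup lborel (\<lambda>\<xi>. ennreal \<bar>hhat \<alpha> \<beta> w \<xi>\<bar>)
               / ennreal ((exp (pi * w / \<alpha>) - exp (- (pi * w / \<alpha>)))\<^sup>2)"
proof -
  note w = assms(1) and \<alpha> = assms(2) and \<beta> = assms(3)
  define q where "q = (exp (pi * w / \<alpha>) - exp (- (pi * w / \<alpha>)))\<^sup>2"
  define r where "r = (exp (pi * w / \<alpha>) + exp (- (pi * w / \<alpha>)))\<^sup>2"
  have q: "q > 0" using \<alpha> w by (simp add: q_def)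
  have "exp (pi * w / \<alpha>) + exp (- (pi * w / \<alpha>)) > 0" by (simp add: add_pos_pos)
  hence r: "r > 0" by (simp add: r_def)
  define h where "h \<xi> = ennreal \<bar>hhat \<alpha> \<beta> w \<xi>\<bar>" for \<xi>
  have [measurable]: "h \<in> borel_measurable lborel"
    unfolding h_def by (rule hhat_ennreal_measurable[OF \<beta>])
  define G where "G = cauchy_gabor \<alpha> \<beta> w"
  define \<kappa> where "\<kappa> = pi / \<alpha>"
  have \<kappa>: "\<kappa> > 0" "4 * pi / \<alpha> = 4 * \<kappa>" using \<alpha> by (auto simp: \<kappa>_def)
  have G: "G i \<in> L2" for i unfolding G_def by (rule cauchy_gabor_square_integrable[OF w])
  \<comment> \<open>Boundedness of \<open>hhat\<close> makes both candidate constants finite, as the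
    extension from truncations to all of \<open>L2\<close> requires.\<close>
  obtain K where "\<And>\<xi>. hhat \<alpha> \<beta> w \<xi> \<le> K" using hhat_bounded[OF \<beta> w] by blast
  hence hK: "h \<xi> \<le> ennreal K" for \<xi> using hhat_nn(2)[OF \<beta>, of \<alpha> w \<xi>] by (simp add: h_def ennreal_leI)
  hence "esssup lborel h \<le> ennreal K" by (intro esssup_I) (auto intro: hK)
  hence sup_fin: "esssup lborel h < \<infinity>" by (rule order.strict_trans1) simp
  have "essinf lborel h \<le> ennreal K"
  proof -
    have "AE \<xi> in lborel. essinf lborel h \<le> h \<xi>" by (rule essinf_AE) measurable
    hence "AE (\<xi>::real) in lborel. essinf lborel h \<le> ennreal K"
      by (rule eventually_mono) (rule order.trans[OF _ hK])
    \<comment> \<open>An almost everywhere statement that does not mention the point is true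
      outright, because the whole line is not a null set.\<close>
    thus ?thesis by (simp add: eventually_const_iff ae_filter_eq_bot_iff)
  qed
  hence inf_fin: "essinf lborel h < \<infinity>" by (rule order.strict_trans1) simp
  have fin: "ennreal \<kappa> * x / ennreal c < \<infinity>" if "x < \<infinity>" "c > 0" for x c
    using that by (simp add: divide_ennreal_def ennreal_mult_less_top inverse_ennreal)
  have bd: "frame_sum G (truncate n f) \<le> ennreal \<kappa> * esssup lborel h / ennreal (q / 4) * (\<integral>\<^sup>+t. ennreal ((norm (truncate n f t))\<^sup>2) \<partial>lborel)"
    "ennreal \<kappa> * essinf lborel h / ennreal (r / 4) * (\<integral>\<^sup>+t. ennreal ((norm (truncate n f t))\<^sup>2) \<partial>lborel) \<le> frame_sum G (truncate n f)"
    if "f \<in> L2" for n f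
  proof -
    have [measurable]: "f \<in> borel_measurable borel" using that by (simp add: L2_def)
    show "frame_sum G (truncate n f) \<le> ennreal \<kappa> * esssup lborel h / ennreal (q / 4) * (\<integral>\<^sup>+t. ennreal ((norm (truncate n f t))\<^sup>2) \<partial>lborel)"
      "ennreal \<kappa> * essinf lborel h / ennreal (r / 4) * (\<integral>\<^sup>+t. ennreal ((norm (truncate n f t))\<^sup>2) \<partial>lborel) \<le> frame_sum G (truncate n f)"
      unfolding \<kappa>_def h_def q_def r_def G_def
      by (rule frame_sum_bounded_support[OF \<alpha> \<beta> w _ truncate_bounded(1) truncate_bounded(2)]; simp)+
  qed
  have upper: "upper_frame_bound G (ennreal \<kappa> * esssup lborel h / ennreal (q / 4))"
    using fin[OF sup_fin] q by (intro upper_frame_bound_from_bounded_support G bd) auto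
  have lower: "lower_frame_bound G (ennreal \<kappa> * essinf lborel h / ennreal (r / 4))"
    using fin[OF sup_fin, of "q / 4"] fin[OF inf_fin, of "r / 4"] q r
    by (intro lower_frame_bound_from_bounded_support[OF G _ upper] bd) auto
  have A: "lower_frame_const G \<le> ennreal \<kappa> * essinf lborel h / ennreal (q / 4)"
  proof -
    \<comment> \<open>The optimal constant is itself a lower frame bound, so it can be tested at
      every continuity point of \<open>hhat\<close>; the resulting almost everywhere lower bound for
      h is at most the essential infimum.\<close>
    have "AE \<xi> in lborel. lower_frame_const G * ennreal (q / 4) / ennreal \<kappa> \<le> h \<xi>"
      using AE_isCont_hhat[OF \<alpha> \<beta>, of w]
    proof eventually_elim
      case (elim \<xi>)
      from frame_bounds_imp_hhat_bounds(1)[OF \<alpha> \<beta> w this, of "lower_frame_const G"]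
      have "lower_frame_const G * ennreal (q / 4) \<le> ennreal \<kappa> * h \<xi>"
        using lower_frame_const_greatest(1)[of G] by (simp add: G_def q_def \<kappa>_def h_def)
      thus ?case by (simp add: ennreal_divide_le_iff[OF \<kappa>(1)])
    qed
    hence "lower_frame_const G * ennreal (q / 4) / ennreal \<kappa> \<le> essinf lborel h" by (rule essinf_I[rotated]) measurable
    thus ?thesis using q by (simp add: ennreal_divide_le_iff[OF \<kappa>(1)] ennreal_le_divide_iff mult.commute)
  qed
  have B: "ennreal \<kappa> * esssup lborel h / ennreal (r / 4) \<le> upper_frame_const G"
  proof -
    \<comment> \<open>Dually, the least upper frame bound is itself a bound, and testing it at
      continuity points gives an almost everywhere upper bound for h.\<close>
    have "AE \<xi> in lborel. h \<xi> \<le> upper_frame_const G * ennreal (r / 4) / ennreal \<kappa>"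
      using AE_isCont_hhat[OF \<alpha> \<beta>, of w]
    proof eventually_elim
      case (elim \<xi>)
      from frame_bounds_imp_hhat_bounds(2)[OF \<alpha> \<beta> w this, of "upper_frame_const G"]
      have "ennreal \<kappa> * h \<xi> \<le> upper_frame_const G * ennreal (r / 4)"
        using upper_frame_const_least(1)[of G] by (simp add: G_def r_def \<kappa>_def h_def)
      thus ?case by (simp add: ennreal_le_divide_iff[OF \<kappa>(1)])
    qed
    hence "esssup lborel h \<le> upper_frame_const G * ennreal (r / 4) / ennreal \<kappa>" by (intro esssup_I) measurable
    thus ?thesis using r by (simp add: ennreal_divide_le_iff ennreal_le_divide_iff[OF \<kappa>(1)] mult.commute)
  qed
  show ?thesis
    using lower_frame_const_greatest(2)[OF lower] A B upper_frame_const_least(2)[OF upper]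
    unfolding G_def[symmetric] h_def[symmetric] q_def[symmetric] r_def[symmetric] \<kappa>(2)
      ennreal_four_divide[OF \<kappa>(1) q] ennreal_four_divide[OF \<kappa>(1) r] by blast
qed

end
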